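(* For $n\in\mathbb Z_{>0}$ let $b_n=\max\{h(w)\}$, the maximum over all words $w$ of length $2n$ in even integers. The sequence $(b_n)_{n\ge1}$ is non-decreasing. For all $n\in\mathbb Z_{>0}$, $$\binom{2n}{n}\le b_{2n+1}\le \frac{1}{2n+2}\binom{4n+2}{2n+1},\qquad \binom{2n-1}{n}\le b_{2n}\le\frac{1}{2n+1}\binom{4n}{2n}.$$ In particular, for any real $0<a<2$ we have $b_n\ge a^n$ for all sufficiently large $n$.
   Context: Fix $q\in\mathbb C^\times$ not a root of unity. $U=U_q\widehat{\mathfrak{sl}}_2$ (level zero) is the unital associative $\mathbb C$-algebra with generators $e_0,e_1,f_0,f_1,K^{\pm1}$ and relations $KK^{-1}=K^{-1}K=1$, $Ke_1K^{-1}=q^2e_1$, $Kf_1K^{-1}=q^{-2}f_1$, $Ke_0K^{-1}=q^{-2}e_0$, $Kf_0K^{-1}=q^{2}f_0$, $[e_1,f_1]=-[e_0,f_0]=\frac{K-K^{-1}}{q-q^{-1}}$, $[e_1,f_0]=[e_0,f_1]=0$, and for $i\neq j$ in $\{0,1\}$: $e_i^3e_j-(q^2+1+q^{-2})e_i^2e_je_i+(q^2+1+q^{-2})e_ie_je_i^2-e_je_i^3=0$ and the same relation with $e$ replaced by $f$. Tensor products of $U$-modules are formed with the coproduct $\Delta(K^{\pm1})=K^{\pm1}\otimes K^{\pm1}$, $\Delta(e_0)=e_0\otimes K^{-1}+1\otimes e_0$, $\Delta(f_0)=f_0\otimes 1+K\otimes f_0$, $\Delta(e_1)=e_1\otimes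 K+1\otimes e_1$, $\Delta(f_1)=f_1\otimes 1+K^{-1}\otimes f_1$. The trivial module $\mathbb C$ has $e_i,f_i$ acting by $0$ and $K$ by $1$. For $a\in 2\mathbb Z$ the two-dimensional evaluation module, denoted simply $a$, has basis $v_+,v_-$ with $Kv_\pm=q^{\pm1}v_\pm$, $e_1v_-=v_+$, $e_1v_+=0$, $f_1v_+=v_-$, $f_1v_-=0$, and $e_0,f_0$ acting as $q^{a}f_1$, $q^{-a}e_1$ respectively. A word $w=(a_1,\dots,a_k)$ of length $k$ is a sequence of even integers, also regarded as the $U$-module $a_1\otimes\cdots\otimes a_k$; $h(w)=\dim\mathrm{Hom}_U(\mathbb C,w)$. *)

theory Defs
  imports Complex_Main "Jordan_Normal_Form.VS_Connect" "Jordan_Normal_Form.DL_Rank"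
begin

datatype ugen = E0 | E1 | F0 | F1 | Kp | Km

text \<open>
  Expressions in the generators; \<open>Kp\<close> stands for $K$ and \<open>Km\<close> for $K^{-1}$. The algebra $U$ is the quotient of the expressions by the
  congruence \<open>U_eq q\<close> below, the smallest one for which the quotient is a unital
  associative complex algebra satisfying the defining relations.
\<close>

datatype uexpr = Gen ugen | Scal complex | Add uexpr uexpr | Mul uexpr uexpr

instantiation uexpr :: "{plus, times, minus}"
begin
definition "x + y = Add x y"
definition "x * y = Mul x y"
definition "x - y = Add x (Mul (Scal (-1)) y)"
instance ..
end

definition commutator :: "uexpr \<Rightarrow> uexpr \<Rightarrow> uexpr" where
  "commutator x y = x * y - y * x"

definition serre :: "complex \<Rightarrow> uexpr \<Rightarrow> uexpr \<Rightarrow> uexpr" where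
  "serre q x y =
     x * x * x * y - Scal (q^2 + 1 + 1 / q^2) * (x * x * y * x)
     + Scal (q^2 + 1 + 1 / q^2) * (x * y * x * x) - y * x * x * x"

definition U_relations :: "complex \<Rightarrow> (uexpr \<times> uexpr) set" where
  "U_relations q =
    (let e\<^sub>0 = Gen E0; e\<^sub>1 = Gen E1; f\<^sub>0 = Gen F0; f\<^sub>1 = Gen F1; k = Gen Kp; k' = Gen Km;
         z = Scal (1 / (q - 1 / q)) * (k - k')
     in {(k * k', Scal 1), (k' * k, Scal 1),
         (k * e\<^sub>1 * k', Scal (q^2) * e\<^sub>1), (k * f\<^sub>1 * k', Scal (1 / q^2) * f\<^sub>1),
         (k * e\<^sub>0 * k', Scal (1 / q^2) * e\<^sub>0), (k * f\<^sub>0 * k', Scal (q^2) * f\<^sub>0),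
         (commutator e\<^sub>1 f\<^sub>1, z), (commutator e\<^sub>0 f\<^sub>0, Scal (-1) * z),
         (commutator e\<^sub>1 f\<^sub>0, Scal 0), (commutator e\<^sub>0 f\<^sub>1, Scal 0),
         (serre q e\<^sub>0 e\<^sub>1, Scal 0), (serre q e\<^sub>1 e\<^sub>0, Scal 0),
         (serre q f\<^sub>0 f\<^sub>1, Scal 0), (serre q f\<^sub>1 f\<^sub>0, Scal 0)})"

inductive U_eq :: "complex \<Rightarrow> uexpr \<Rightarrow> uexpr \<Rightarrow> bool" for q where
  rel: "(x, y) \<in> U_relations q \<Longrightarrow> U_eq q x y"
| refl: "U_eq q x x"
| sym: "U_eq q x y \<Longrightarrow> U_eq q y x"
| trans: "U_eq q x y \<Longrightarrow> U_eq q y z \<Longrightarrow> U_eq q x z"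
| add_cong: "U_eq q x x' \<Longrightarrow> U_eq q y y' \<Longrightarrow> U_eq q (x + y) (x' + y')"
| mul_cong: "U_eq q x x' \<Longrightarrow> U_eq q y y' \<Longrightarrow> U_eq q (x * y) (x' * y')"
| add_assoc: "U_eq q (x + y + z) (x + (y + z))"
| add_comm: "U_eq q (x + y) (y + x)"
| add_zero: "U_eq q (Scal 0 + x) x"
| add_inv: "U_eq q (x - x) (Scal 0)"
| mul_assoc: "U_eq q (x * y * z) (x * (y * z))"
| mul_one: "U_eq q (Scal 1 * x) x"
| distl: "U_eq q (x * (y + z)) (x * y + x * z)"
| distr: "U_eq q ((x + y) * z) (x * z + y * z)"
| scal_add: "U_eq q (Scal (a + b)) (Scal a + Scal b)"
| scal_mul: "U_eq q (Scal (a * b)) (Scal a * Scal b)"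
| scal_central: "U_eq q (Scal a * x) (x * Scal a)"


text \<open>
  A finite-dimensional module is given by the matrices of the generators in an ordered basis.
\<close>

record umod =
  udim :: nat
  gmat :: "ugen \<Rightarrow> complex mat"

primrec act :: "umod \<Rightarrow> uexpr \<Rightarrow> complex mat" where
  "act M (Gen g) = gmat M g"
| "act M (Scal c) = c \<cdot>\<^sub>m 1\<^sub>m (udim M)"
| "act M (Add x y) = act M x + act M y"
| "act M (Mul x y) = act M x * act M y"

text \<open>
  The second condition says that the action of expressions factors through the quotient $U$.
\<close>

definition U_module :: "complex \<Rightarrow> umod \<Rightarrow> bool" where
  "U_module q M \<longleftrightarrow>
     (\<forall>g. gmat M g \<in> carrier_mat (udim M) (udim M)) \<and>
     (\<forall>x y. U_eq q x y \<longrightarrow> act M x = act M y)"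

definition trivial_module :: umod where
  "trivial_module = \<lparr>udim = 1,
     gmat = (\<lambda>g. if g \<in> {Kp, Km} then 1\<^sub>m 1 else 0\<^sub>m 1 1)\<rparr>"

text \<open>The first basis vector is $v_+$, the second one is $v_-$.\<close>

definition mat2 :: "complex \<Rightarrow> complex \<Rightarrow> complex \<Rightarrow> complex \<Rightarrow> complex mat" where
  "mat2 a b c d = mat_of_rows_list 2 [[a, b], [c, d]]"

primrec eval_gmat :: "complex \<Rightarrow> int \<Rightarrow> ugen \<Rightarrow> complex mat" where
  "eval_gmat q a E1 = mat2 0 1 0 0"
| "eval_gmat q a F1 = mat2 0 0 1 0"
| "eval_gmat q a E0 = q powi a \<cdot>\<^sub>m mat2 0 0 1 0"
| "eval_gmat q a F0 = q powi (- a) \<cdot>\<^sub>m mat2 0 1 0 0"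
| "eval_gmat q a Kp = mat2 q 0 0 (1 / q)"
| "eval_gmat q a Km = mat2 (1 / q) 0 0 q"

definition eval_module :: "complex \<Rightarrow> int \<Rightarrow> umod" where
  "eval_module q a = \<lparr>udim = 2, gmat = eval_gmat q a\<rparr>"

text \<open>
  Kronecker product: the basis vector $v_i \otimes w_j$ of a tensor product is the one with
  number $i \cdot n + j$, where $n$ is the dimension of the second factor.
\<close>

definition kron :: "complex mat \<Rightarrow> complex mat \<Rightarrow> complex mat" where
  "kron A B = mat (dim_row A * dim_row B) (dim_col A * dim_col B)
     (\<lambda>(i, j). A $$ (i div dim_row B, j div dim_col B) * B $$ (i mod dim_row B, j mod dim_col B))"

primrec tensor_gmat :: "umod \<Rightarrow> umod \<Rightarrow> ugen \<Rightarrow> complex mat" where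
  "tensor_gmat M N Kp = kron (gmat M Kp) (gmat N Kp)"
| "tensor_gmat M N Km = kron (gmat M Km) (gmat N Km)"
| "tensor_gmat M N E0 = kron (gmat M E0) (gmat N Km) + kron (1\<^sub>m (udim M)) (gmat N E0)"
| "tensor_gmat M N F0 = kron (gmat M F0) (1\<^sub>m (udim N)) + kron (gmat M Kp) (gmat N F0)"
| "tensor_gmat M N E1 = kron (gmat M E1) (gmat N Kp) + kron (1\<^sub>m (udim M)) (gmat N E1)"
| "tensor_gmat M N F1 = kron (gmat M F1) (1\<^sub>m (udim N)) + kron (gmat M Km) (gmat N F1)"

definition tensor_module :: "umod \<Rightarrow> umod \<Rightarrow> umod" where
  "tensor_module M N = \<lparr>udim = udim M * udim N, gmat = tensor_gmat M N\<rparr>"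

text \<open>Linear maps from $M$ to $N$ are matrices with \<open>udim N\<close> rows and \<open>udim M\<close> columns.\<close>

definition Hom_U :: "umod \<Rightarrow> umod \<Rightarrow> complex mat set" where
  "Hom_U M N = {T \<in> carrier_mat (udim N) (udim M). \<forall>x. T * act M x = act N x * T}"

definition dim_Hom_U :: "umod \<Rightarrow> umod \<Rightarrow> nat" where
  "dim_Hom_U M N = vectorspace.dim (class_ring :: complex ring)
     ((module_mat TYPE(complex) (udim N) (udim M))\<lparr>carrier := Hom_U M N\<rparr>)"


definition words :: "nat \<Rightarrow> int list set" where
  "words k = {w. length w = k \<and> (\<forall>a \<in> set w. even a)}"

text \<open>
  The innermost trivial factor is a unit for the tensor product and only serves to start the
  recursion; see \<open>tensor_trivial\<close>.
\<close>

definition word_module :: "complex \<Rightarrow> int list \<Rightarrow> umod" where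
  "word_module q w = foldr (\<lambda>a. tensor_module (eval_module q a)) w trivial_module"

definition hom_dim :: "complex \<Rightarrow> int list \<Rightarrow> nat" where
  "hom_dim q w = dim_Hom_U trivial_module (word_module q w)"

text \<open>
  The set of words is infinite, but the set of dimensions is finite and nonempty by
  \<open>hom_dim_words\<close> below.
\<close>

definition b_seq :: "complex \<Rightarrow> nat \<Rightarrow> nat" where
  "b_seq q n = Max (hom_dim q ` words (2 * n))"


section \<open>Well-definedness: the modules above satisfy the relations, and the maximum exists\<close>

lemmas uexpr_ops = plus_uexpr_def times_uexpr_def minus_uexpr_def

lemma act_simps [simp]:
  "act M (x + y) = act M x + act M y"
  "act M (x * y) = act M x * act M y"
  "act M (x - y) = act M x + (((-1) \<cdot>\<^sub>m 1\<^sub>m (udim M)) * act M y)"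
  by (simp_all add: uexpr_ops)

lemma act_carrier:
  assumes "\<And>g. gmat M g \<in> carrier_mat (udim M) (udim M)"
  shows "act M x \<in> carrier_mat (udim M) (udim M)"
  using assms by (induction x) auto

lemma U_moduleI:
  assumes c: "\<And>g. gmat M g \<in> carrier_mat (udim M) (udim M)"
    and r: "\<And>x y. (x, y) \<in> U_relations q \<Longrightarrow> act M x = act M y"
  shows "U_module q M"
proof -
  note a = act_carrier[of M, OF c]
  let ?n = "udim M"
  have "act M x = act M y" if "U_eq q x y" for x y
    using that
  proof induction
    case (rel x y) then show ?case by (rule r)
  next
    case (add_assoc x y z) then show ?case using a[of x] a[of y] a[of z] by (simp add: assoc_add_mat[of _ ?n ?n])
  next
    case (add_comm x y) then show ?case using a[of x] a[of y] by (simp add: comm_add_mat[of _ ?n ?n])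
  next
    case (add_zero x) then show ?case using a[of x] by (intro eq_matI) auto
  next
    case (add_inv x) then show ?case using a[of x] by (intro eq_matI) (auto simp: mult_smult_assoc_mat[of _ ?n ?n])
  next
    case (mul_assoc x y z) then show ?case using a[of x] a[of y] a[of z] by (simp add: assoc_mult_mat[of _ ?n ?n])
  next
    case (mul_one x) then show ?case using a[of x] by (simp add: mult_smult_assoc_mat[of _ ?n ?n] left_mult_one_mat[of _ ?n ?n]) (metis (no_types, lifting) carrier_matD eq_matI index_smult_mat mult_1)
  next
    case (distl x y z) then show ?case using a[of x] a[of y] a[of z] by (simp add: mult_add_distrib_mat[of _ ?n ?n])
  next
    case (distr x y z) then show ?case using a[of x] a[of y] a[of z] by (simp add: add_mult_distrib_mat[of _ ?n ?n])
  next
    case (scal_add c d) then show ?case by (intro eq_matI) (auto simp: algebra_simps)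
  next
    case (scal_mul c d) then show ?case by (simp add: mult_smult_assoc_mat[of _ ?n ?n]) (intro eq_matI, auto)
  next
    case (scal_central c x) then show ?case using a[of x] by (simp add: mult_smult_assoc_mat[of _ ?n ?n] mult_smult_distrib[of _ ?n ?n _ ?n] left_mult_one_mat[of _ ?n ?n] right_mult_one_mat[of _ ?n ?n])
  qed auto
  then show ?thesis using c unfolding U_module_def by blast
qed

lemma U_module_trivial:
  shows "U_module q trivial_module"
  apply (rule U_moduleI)
  subgoal by (simp add: trivial_module_def)
  subgoal by (auto simp: trivial_module_def U_relations_def Let_def commutator_def serre_def scalar_prod_def intro!: eq_matI)
  done

lemma mat2_carrier: "mat2 a b c d \<in> carrier_mat 2 2"
  by (simp add: mat2_def mat_of_rows_list_def numeral_2_eq_2)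
lemma one_mat2: "1\<^sub>m 2 = mat2 1 0 0 1"
  by (rule eq_matI) (auto simp: mat2_def mat_of_rows_list_def numeral_2_eq_2 less_Suc_eq)
lemma add_mat2: "mat2 a b c d + mat2 a' b' c' d' = mat2 (a+a') (b+b') (c+c') (d+d')"
  by (rule eq_matI) (auto simp: mat2_def mat_of_rows_list_def numeral_2_eq_2 less_Suc_eq)
lemma smult_mat2: "x \<cdot>\<^sub>m mat2 a b c d = mat2 (x*a) (x*b) (x*c) (x*d)"
  by (rule eq_matI) (auto simp: mat2_def mat_of_rows_list_def numeral_2_eq_2 less_Suc_eq)
lemma mult_mat2: "mat2 a b c d * mat2 a' b' c' d' = mat2 (a*a'+b*c') (a*b'+b*d') (c*a'+d*c') (c*b'+d*d')"
  by (rule eq_matI) (auto simp: mat2_def mat_of_rows_list_def numeral_2_eq_2 less_Suc_eq scalar_prod_def)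

lemma U_module_eval:
  assumes "q \<noteq> 0" "q ^ 2 \<noteq> 1"
  shows "U_module q (eval_module q a)"
proof (rule U_moduleI, goal_cases)
  case (1 g) show ?case by (cases g) (auto simp: eval_module_def mat2_carrier)
next
  case (2 x y)
  have nz: "q - 1 / q \<noteq> 0" using assms by (simp add: field_simps power2_eq_square)
  have i: "(q - 1 / q) / (q - 1 / q) = 1" "(1 / q - q) / (q - 1 / q) = -1"
    using nz by (simp_all add: divide_eq_eq)
  have p: "q powi a * q powi (- a) = 1" "q powi (- a) * q powi a = 1" using assms by (simp_all add: power_int_minus)
  show ?case using 2 assms i p
    by (auto simp: eval_module_def U_relations_def Let_def commutator_def serre_def one_mat2 add_mat2 smult_mat2 mult_mat2 power2_eq_square mult_ac)
qed

lemma sum_div_mod: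
  fixes f :: "nat \<Rightarrow> nat \<Rightarrow> complex"
  assumes "n > 0"
  shows "(\<Sum>k<m * n. f (k div n) (k mod n)) = (\<Sum>i<m. \<Sum>j<n. f i j)"
proof -
  have "(\<Sum>k<m * n. f (k div n) (k mod n)) = (\<Sum>i<m. \<Sum>k\<in>{i * n..<i * n + n}. f (k div n) (k mod n))"
    by (rule sum.nat_group[symmetric])
  also have "\<dots> = (\<Sum>i<m. \<Sum>j<n. f i j)"
  proof (rule sum.cong, rule HOL.refl)
    fix i
    have "(\<Sum>k\<in>{0 + i * n..<n + i * n}. f (k div n) (k mod n)) = (\<Sum>j\<in>{0..<n}. f ((j + i * n) div n) ((j + i * n) mod n))"
      by (rule sum.shift_bounds_nat_ivl)
    also have "\<dots> = (\<Sum>j<n. f i j)" using assms by (intro sum.cong) auto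
    finally show "(\<Sum>k\<in>{i * n..<i * n + n}. f (k div n) (k mod n)) = (\<Sum>j<n. f i j)"
      by (simp add: add.commute)
  qed
  finally show ?thesis .
qed

lemma kron_carrier [simp]:
  "A \<in> carrier_mat a b \<Longrightarrow> B \<in> carrier_mat c d \<Longrightarrow> kron A B \<in> carrier_mat (a * c) (b * d)"
  by (auto simp: kron_def)

lemma kron_mult:
  assumes A: "A \<in> carrier_mat m m" and B: "B \<in> carrier_mat n n"
    and C: "C \<in> carrier_mat m m" and D: "D \<in> carrier_mat n n"
  shows "kron A B * kron C D = kron (A * C) (B * D)"
proof (rule eq_matI)
  fix i j assume "i < dim_row (kron (A * C) (B * D))" "j < dim_col (kron (A * C) (B * D))"
  then have ij: "i < m * n" "j < m * n" using A B C D by (auto simp: kron_def)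
  then have n: "n > 0" by (cases n) auto
  have b: "i div n < m" "j div n < m" "i mod n < n" "j mod n < n"
    using ij n by (auto simp: less_mult_imp_div_less)
  have "(kron A B * kron C D) $$ (i, j) =
     (\<Sum>k<m * n. (A $$ (i div n, k div n) * B $$ (i mod n, k mod n)) * (C $$ (k div n, j div n) * D $$ (k mod n, j mod n)))"
    using A B C D ij by (auto simp: kron_def scalar_prod_def lessThan_atLeast0 intro!: sum.cong)
  also have "\<dots> = (\<Sum>k<m. \<Sum>l<n. (A $$ (i div n, k) * B $$ (i mod n, l)) * (C $$ (k, j div n) * D $$ (l, j mod n)))"
    by (rule sum_div_mod[OF n])
  also have "\<dots> = (\<Sum>k<m. A $$ (i div n, k) * C $$ (k, j div n)) * (\<Sum>l<n. B $$ (i mod n, l) * D $$ (l, j mod n))"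
    by (simp add: sum_product mult_ac)
  also have "\<dots> = kron (A * C) (B * D) $$ (i, j)"
    using A B C D ij b by (auto simp: kron_def scalar_prod_def lessThan_atLeast0)
  finally show "(kron A B * kron C D) $$ (i, j) = kron (A * C) (B * D) $$ (i, j)" .
qed (use A B C D in \<open>auto simp: kron_def\<close>)

lemma kron_index:
  assumes "A \<in> carrier_mat m m" "B \<in> carrier_mat n n" "i < m * n" "j < m * n"
  shows "kron A B $$ (i, j) = A $$ (i div n, j div n) * B $$ (i mod n, j mod n)"
  using assms by (auto simp: kron_def)

lemma div_mod_bounds:
  assumes "i < m * (n::nat)" shows "i div n < m" "i mod n < n"
  using assms by (cases n; auto simp: less_mult_imp_div_less)+

lemma kron_one: "kron (1\<^sub>m m) (1\<^sub>m n) = 1\<^sub>m (m * n)"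
proof (rule eq_matI)
  fix i j assume "i < dim_row (1\<^sub>m (m * n))" "j < dim_col (1\<^sub>m (m * n))"
  then have ij: "i < m * n" "j < m * n" by auto
  have e: "i = j \<longleftrightarrow> i div n = j div n \<and> i mod n = j mod n" by (metis div_mult_mod_eq)
  show "kron (1\<^sub>m m) (1\<^sub>m n) $$ (i, j) = 1\<^sub>m (m * n) $$ (i, j)"
    using ij div_mod_bounds[OF ij(1)] div_mod_bounds[OF ij(2)] e
    by (auto simp: kron_index[of _ m _ n])
qed (auto simp: kron_def)

lemma kron_smult:
  assumes "A \<in> carrier_mat m m" "B \<in> carrier_mat n n"
  shows "kron (c \<cdot>\<^sub>m A) B = c \<cdot>\<^sub>m kron A B" "kron A (c \<cdot>\<^sub>m B) = c \<cdot>\<^sub>m kron A B"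
  using assms by (auto intro!: eq_matI simp: kron_def div_mod_bounds)

lemma tensor_trivial:
  assumes c: "\<And>g. gmat M g \<in> carrier_mat (udim M) (udim M)"
  shows "tensor_module M trivial_module = M"
proof -
  have k1: "kron A (1\<^sub>m 1) = A" if "A \<in> carrier_mat n n" for A n
    using that by (intro eq_matI) (auto simp: kron_def)
  have k0: "kron A (0\<^sub>m 1 1) = 0\<^sub>m n n" if "A \<in> carrier_mat n n" for A n
    using that by (intro eq_matI) (auto simp: kron_def)
  have "tensor_gmat M trivial_module g = gmat M g" for g
    using c[of g] c by (cases g) (simp_all del: One_nat_def add: trivial_module_def k1[OF c] k0[OF c] k1[OF one_carrier_mat] k0[OF one_carrier_mat])
  then show ?thesis by (simp add: tensor_module_def trivial_module_def fun_eq_iff)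
qed

definition serre_mat :: "complex \<Rightarrow> complex mat \<Rightarrow> complex mat \<Rightarrow> bool" where
  "serre_mat q X Z \<longleftrightarrow> X * (X * (X * Z)) + (q^2 + 1 + 1 / q^2) \<cdot>\<^sub>m (X * (Z * (X * X)))
     = (q^2 + 1 + 1 / q^2) \<cdot>\<^sub>m (X * (X * (Z * X))) + Z * (X * (X * X))"

lemma act_serre:
  assumes c: "\<And>g. gmat M g \<in> carrier_mat (udim M) (udim M)"
  shows "act M (serre q x y) = act M (Scal 0) \<longleftrightarrow> serre_mat q (act M x) (act M y)"
proof -
  let ?n = "udim M" let ?X = "act M x" let ?Z = "act M y"
  have a: "?X \<in> carrier_mat ?n ?n" "?Z \<in> carrier_mat ?n ?n" using act_carrier[of M, OF c] by auto
  define A B C D where "A = ?X * (?X * (?X * ?Z))" and "B = ?X * (?X * (?Z * ?X))"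
    and "C = ?X * (?Z * (?X * ?X))" and "D = ?Z * (?X * (?X * ?X))"
  have car: "A \<in> carrier_mat ?n ?n" "B \<in> carrier_mat ?n ?n" "C \<in> carrier_mat ?n ?n" "D \<in> carrier_mat ?n ?n"
    using a unfolding A_def B_def C_def D_def by auto
  have as: "?X * ?X * ?X * ?Z = A" "?X * ?X * ?Z * ?X = B" "?X * ?Z * ?X * ?X = C" "?Z * ?X * ?X * ?X = D"
    using a unfolding A_def B_def C_def D_def by (simp_all add: assoc_mult_mat[of _ ?n ?n _ ?n _ ?n])
  let ?c = "q^2 + 1 + 1 / q^2"
  have "act M (serre q x y) = A + (-1) \<cdot>\<^sub>m (?c \<cdot>\<^sub>m B) + ?c \<cdot>\<^sub>m C + (-1) \<cdot>\<^sub>m D"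
    unfolding serre_def using car by (simp add: as mult_smult_assoc_mat[of _ ?n ?n _ ?n])
  moreover have "A + (-1) \<cdot>\<^sub>m (?c \<cdot>\<^sub>m B) + ?c \<cdot>\<^sub>m C + (-1) \<cdot>\<^sub>m D = 0 \<cdot>\<^sub>m 1\<^sub>m ?n \<longleftrightarrow> A + ?c \<cdot>\<^sub>m C = ?c \<cdot>\<^sub>m B + D"
    using car by (auto simp: mat_eq_iff algebra_simps)
  ultimately show ?thesis by (simp add: serre_mat_def A_def B_def C_def D_def)
qed

lemma expand4:
  fixes A B C D E F G H :: "complex mat"
  assumes car: "A \<in> carrier_mat n n" "B \<in> carrier_mat n n" "C \<in> carrier_mat n n" "D \<in> carrier_mat n n"
     "E \<in> carrier_mat n n" "F \<in> carrier_mat n n" "G \<in> carrier_mat n n" "H \<in> carrier_mat n n"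
   and ij: "i < n" "j < n"
  shows "((A + B) * ((C + D) * ((E + F) * (G + H)))) $$ (i, j)
   = (A*(C*(E*G))) $$ (i, j) + (A*(C*(E*H))) $$ (i, j) + (A*(C*(F*G))) $$ (i, j) + (A*(C*(F*H))) $$ (i, j)
   + (A*(D*(E*G))) $$ (i, j) + (A*(D*(E*H))) $$ (i, j) + (A*(D*(F*G))) $$ (i, j) + (A*(D*(F*H))) $$ (i, j)
   + (B*(C*(E*G))) $$ (i, j) + (B*(C*(E*H))) $$ (i, j) + (B*(C*(F*G))) $$ (i, j) + (B*(C*(F*H))) $$ (i, j)
   + (B*(D*(E*G))) $$ (i, j) + (B*(D*(E*H))) $$ (i, j) + (B*(D*(F*G))) $$ (i, j) + (B*(D*(F*H))) $$ (i, j)"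
proof -
  have 1: "U * (V + W) = U * V + U * W" "(V + W) * U = V * U + W * U" "(V + W) $$ (i, j) = V $$ (i, j) + W $$ (i, j)"
    if "U \<in> carrier_mat n n" "V \<in> carrier_mat n n" "W \<in> carrier_mat n n" for U V W :: "complex mat"
    using that ij by (auto simp: mult_add_distrib_mat[of _ n n _ n] add_mult_distrib_mat[of _ n n _ _ n])
  note es = 1(3)[OF car(1)]
  note cl = mult_carrier_mat[of _ n n _ n] add_carrier_mat
  have 2: "(E + F) * (G + H) = E * G + E * H + (F * G + F * H)"
    by (simp only: 1(2) car cl) (simp only: 1(1) car cl)
  have 3: "((A + B) * ((C + D) * (S + T))) $$ (i, j) = (A * (C * S)) $$ (i, j) + (A * (C * T)) $$ (i, j) + (A * (D * S)) $$ (i, j) + (A * (D * T)) $$ (i, j)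
    + (B * (C * S)) $$ (i, j) + (B * (C * T)) $$ (i, j) + (B * (D * S)) $$ (i, j) + (B * (D * T)) $$ (i, j)"
    if st: "S \<in> carrier_mat n n" "T \<in> carrier_mat n n" for S T
  proof -
    have "(C + D) * (S + T) = (C * S + C * T) + (D * S + D * T)"
      by (simp only: 1(2) car cl st) (simp only: 1(1) car cl st)
    note 4 = this
    show ?thesis unfolding 4 by (simp only: es 1(1,2) car cl st) (simp add: add_ac)
  qed
  have car2: "E * G + E * H \<in> carrier_mat n n" "F * G + F * H \<in> carrier_mat n n" using car by (auto intro: cl)
  show ?thesis unfolding 2 3[OF car2]
    by (simp only: es 1(1,2) car cl) (simp add: add_ac)
qed

lemma serre_mat_add:
  assumes car: "X \<in> carrier_mat n n" "Y \<in> carrier_mat n n" "X' \<in> carrier_mat n n" "Y' \<in> carrier_mat n n"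
    and q: "q \<noteq> 0"
    and XY: "X * Y = q^2 \<cdot>\<^sub>m (Y * X)" and XY': "X * Y' = (1 / q^2) \<cdot>\<^sub>m (Y' * X)"
    and X'Y: "X' * Y = (1 / q^2) \<cdot>\<^sub>m (Y * X')" and X'Y': "X' * Y' = q^2 \<cdot>\<^sub>m (Y' * X')"
    and SX: "serre_mat q X X'" and SY: "serre_mat q Y Y'"
  shows "serre_mat q (X + Y) (X' + Y')"
proof -
  define r where "r = q^2"
  define p where "p = 1 / r"
  have pr: "p * r = 1" using q by (simp_all add: p_def r_def)
  note f = p_def[symmetric] r_def[symmetric]
  note cl = mult_carrier_mat[of _ n n _ n] add_carrier_mat smult_carrier_mat
  show ?thesis
  proof (unfold serre_mat_def f, rule eq_matI, goal_cases)
    case (1 i j)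
    then have ij: "i < n" "j < n" using car by auto
    have base: "(U * V) = c \<cdot>\<^sub>m (V * U) \<Longrightarrow> (U * (V * W)) $$ (i, j) = c * (V * (U * W)) $$ (i, j)"
      "(U * V) = c \<cdot>\<^sub>m (V * U) \<Longrightarrow> (Z * (U * (V * W))) $$ (i, j) = c * (Z * (V * (U * W))) $$ (i, j)"
      "(U * V) = c \<cdot>\<^sub>m (V * U) \<Longrightarrow> (Z * (W * (U * V))) $$ (i, j) = c * (Z * (W * (V * U))) $$ (i, j)"
      if c: "U \<in> carrier_mat n n" "V \<in> carrier_mat n n" "W \<in> carrier_mat n n" "Z \<in> carrier_mat n n" for U V W Z :: "complex mat" and c
    proof -
      assume uv: "(U * V) = c \<cdot>\<^sub>m (V * U)"
      have cs: "V * U \<in> carrier_mat n n" "W * U \<in> carrier_mat n n" "U * W \<in> carrier_mat n n" "V * (U * W) \<in> carrier_mat n n" "W * (V * U) \<in> carrier_mat n n"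
        "Z * (V * (U * W)) \<in> carrier_mat n n" "Z * (W * (V * U)) \<in> carrier_mat n n"
        using c by auto
      have "U * (V * W) = U * V * W" by (rule assoc_mult_mat[symmetric]) (rule c)+
      also have "\<dots> = c \<cdot>\<^sub>m (V * U * W)" unfolding uv by (rule mult_smult_assoc_mat[OF cs(1) c(3)])
      also have "V * U * W = V * (U * W)" by (rule assoc_mult_mat) (rule c)+
      finally have 1: "U * (V * W) = c \<cdot>\<^sub>m (V * (U * W))" .
      have 2: "Z * (c \<cdot>\<^sub>m (V * (U * W))) = c \<cdot>\<^sub>m (Z * (V * (U * W)))" by (rule mult_smult_distrib[OF c(4) cs(4)])
      have 3: "Z * (W * (c \<cdot>\<^sub>m (V * U))) = c \<cdot>\<^sub>m (Z * (W * (V * U)))"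
        unfolding mult_smult_distrib[OF c(3) cs(1)] by (rule mult_smult_distrib[OF c(4) cs(5)])
      have sm: "(c \<cdot>\<^sub>m S) $$ (i, j) = c * S $$ (i, j)" if "S \<in> carrier_mat n n" for S :: "complex mat"
        using that ij by auto
      show "(U * (V * W)) $$ (i, j) = c * (V * (U * W)) $$ (i, j)" unfolding 1 by (rule sm[OF cs(4)])
      show "(Z * (U * (V * W))) $$ (i, j) = c * (Z * (V * (U * W))) $$ (i, j)" unfolding 1 2 by (rule sm[OF cs(6)])
      show "(Z * (W * (U * V))) $$ (i, j) = c * (Z * (W * (V * U))) $$ (i, j)" unfolding uv 3 by (rule sm[OF cs(7)])
    qed
    note R = XY[unfolded f] XY'[unfolded f] X'Y[unfolded f] X'Y'[unfolded f]
    note N = base[OF car(1,2) _ _ R(1)] base[OF car(1,4) _ _ R(2)] base[OF car(3,2) _ _ R(3)] base[OF car(3,4) _ _ R(4)]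
    have en: "(S + c \<cdot>\<^sub>m T = c \<cdot>\<^sub>m U + V) = (S + c \<cdot>\<^sub>m T = c \<cdot>\<^sub>m U + V)"
      "(S + c \<cdot>\<^sub>m T) $$ (i, j) = S $$ (i, j) + c * T $$ (i, j)" "(c \<cdot>\<^sub>m T + S) $$ (i, j) = c * T $$ (i, j) + S $$ (i, j)"
      "(S + c \<cdot>\<^sub>m T = c \<cdot>\<^sub>m U + V) \<Longrightarrow> S $$ (i, j) + c * T $$ (i, j) = c * U $$ (i, j) + V $$ (i, j)"
      if "S \<in> carrier_mat n n" "T \<in> carrier_mat n n" "U \<in> carrier_mat n n" "V \<in> carrier_mat n n" for S T U V :: "complex mat" and c
    proof -
      have 1: "(S + c \<cdot>\<^sub>m T) $$ (i, j) = S $$ (i, j) + c * T $$ (i, j)" using that ij by auto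
      have 2: "(c \<cdot>\<^sub>m U + V) $$ (i, j) = c * U $$ (i, j) + V $$ (i, j)" using that ij by auto
      show "(S + c \<cdot>\<^sub>m T) $$ (i, j) = S $$ (i, j) + c * T $$ (i, j)" by (rule 1)
      show "(c \<cdot>\<^sub>m T + S) $$ (i, j) = c * T $$ (i, j) + S $$ (i, j)" using that ij by auto
      show "(S + c \<cdot>\<^sub>m T = c \<cdot>\<^sub>m U + V) \<Longrightarrow> S $$ (i, j) + c * T $$ (i, j) = c * U $$ (i, j) + V $$ (i, j)"
       using 1 2 by simp
    qed simp
    have cc: "P * (Q * (R * S)) \<in> carrier_mat n n"
      if "P \<in> carrier_mat n n" "Q \<in> carrier_mat n n" "R \<in> carrier_mat n n" "S \<in> carrier_mat n n" for P Q R S :: "complex mat" using that by auto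
    have xy: "X + Y \<in> carrier_mat n n" "X' + Y' \<in> carrier_mat n n" using car by auto
    note e1 = en(4)[OF cc cc cc cc, OF car(1,1,1,3) car(1,3,1,1) car(1,1,3,1) car(3,1,1,1) SX[unfolded serre_mat_def f]]
    note e2 = en(4)[OF cc cc cc cc, OF car(2,2,2,4) car(2,4,2,2) car(2,2,4,2) car(4,2,2,2) SY[unfolded serre_mat_def f]]
    note cl' = car cl N
    note x1 = expand4[OF car(1,2) car(1,2) car(1,2) car(3,4) ij]
    note x2 = expand4[OF car(1,2) car(3,4) car(1,2) car(1,2) ij]
    note x3 = expand4[OF car(1,2) car(1,2) car(3,4) car(1,2) ij]
    note x4 = expand4[OF car(3,4) car(1,2) car(1,2) car(1,2) ij]
    have pp: "p * (r * z) = z" "r * (p * z) = z" "r * p = 1" for z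
      using pr by (simp_all add: mult.assoc[symmetric] mult.commute)
    define e where "e A B C D = (A * (B * (C * D))) $$ (i, j)" for A B C D :: "complex mat"
    have eN: "e U V W Z = c * e V U W Z" "e Z U V W = c * e Z V U W" "e Z W U V = c * e Z W V U"
      if "U * V = c \<cdot>\<^sub>m (V * U)" "U \<in> carrier_mat n n" "V \<in> carrier_mat n n" "W \<in> carrier_mat n n" "Z \<in> carrier_mat n n" for U V W Z c
      unfolding e_def by (rule base; (rule that cl)+)+
    note EN = eN[OF R(1) car(1,2)] eN[OF R(2) car(1,4)] eN[OF R(3) car(3,2)] eN[OF R(4) car(3,4)]
    note E = e1[folded e_def] e2[folded e_def]
    have L: "?case \<longleftrightarrow> e (X+Y) (X+Y) (X+Y) (X'+Y') + (r + 1 + p) * e (X+Y) (X'+Y') (X+Y) (X+Y) =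
       (r + 1 + p) * e (X+Y) (X+Y) (X'+Y') (X+Y) + e (X'+Y') (X+Y) (X+Y) (X+Y)"
      unfolding e_def
      by (subst en(2)[OF cc cc cc cc], (rule xy)+, subst en(3)[OF cc cc cc cc], (rule xy)+, rule HOL.refl)
    have "e (X+Y) (X+Y) (X+Y) (X'+Y') + (r + 1 + p) * e (X+Y) (X'+Y') (X+Y) (X+Y) -
       ((r + 1 + p) * e (X+Y) (X+Y) (X'+Y') (X+Y) + e (X'+Y') (X+Y) (X+Y) (X+Y))
      = (e X X X X' + (r + 1 + p) * e X X' X X - ((r + 1 + p) * e X X X' X + e X' X X X))
      + (e Y Y Y Y' + (r + 1 + p) * e Y Y' Y Y - ((r + 1 + p) * e Y Y Y' Y + e Y' Y Y Y))"
      unfolding x1[folded e_def] x2[folded e_def] x3[folded e_def] x4[folded e_def]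
      apply (simp only: EN car)
      apply (simp add: algebra_simps pp)
      done
    then show ?case unfolding L E by simp
  qed (use car in auto)
qed

lemma kron_dims [simp]: "dim_row (kron A B) = dim_row A * dim_row B" "dim_col (kron A B) = dim_col A * dim_col B"
  by (simp_all add: kron_def)

lemma kron_eqI:
  assumes "S \<in> carrier_mat (m * n) (m * n)" "T \<in> carrier_mat (m * n) (m * n)"
   and "\<And>i j. i < m * n \<Longrightarrow> j < m * n \<Longrightarrow> i div n < m \<Longrightarrow> j div n < m \<Longrightarrow> i mod n < n \<Longrightarrow> j mod n < n \<Longrightarrow> S $$ (i, j) = T $$ (i, j)"
  shows "S = T"
  using assms by (intro eq_matI) (auto simp: div_mod_bounds)

lemma serre_kron:
  fixes A B G H W :: "complex mat"
  assumes car: "A \<in> carrier_mat m m" "B \<in> carrier_mat m m" "G \<in> carrier_mat n n" "H \<in> carrier_mat n n" "W \<in> carrier_mat n n"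
    and S: "serre_mat q A B"
    and W: "G * (G * (G * H)) = W" "G * (H * (G * G)) = W" "G * (G * (H * G)) = W" "H * (G * (G * G)) = W"
  shows "serre_mat q (kron A G) (kron B H)" "serre_mat q (kron G A) (kron H B)"
proof -
  let ?c = "q^2 + 1 + 1 / q^2"
  note cl = mult_carrier_mat[of _ m m _ m] mult_carrier_mat[of _ n n _ n]
  define P Q R T where "P = A * (A * (A * B))" and "Q = A * (B * (A * A))" and "R = A * (A * (B * A))" and "T = B * (A * (A * A))"
  have c: "P \<in> carrier_mat m m" "Q \<in> carrier_mat m m" "R \<in> carrier_mat m m" "T \<in> carrier_mat m m"
    unfolding P_def Q_def R_def T_def using car by auto
  have "P + ?c \<cdot>\<^sub>m Q = ?c \<cdot>\<^sub>m R + T" using S unfolding serre_mat_def P_def Q_def R_def T_def .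
  then have *: "P $$ (i, j) + ?c * Q $$ (i, j) = ?c * R $$ (i, j) + T $$ (i, j)" if "i < m" "j < m" for i j
    using that c by (auto dest!: arg_cong[of _ _ "\<lambda>M. M $$ (i, j)"])
  have **: "x * P $$ (i, j) + ?c * (x * Q $$ (i, j)) = ?c * (x * R $$ (i, j)) + x * T $$ (i, j)" if "i < m" "j < m" for i j x
    using arg_cong[OF *[OF that], of "\<lambda>z. x * z"] by (simp only: distrib_left mult.left_commute)
  have ***: "P $$ (i, j) * x + ?c * (Q $$ (i, j) * x) = ?c * (R $$ (i, j) * x) + T $$ (i, j) * x" if "i < m" "j < m" for i j x
    using **[OF that, of x] by (simp only: mult.commute)
  show "serre_mat q (kron A G) (kron B H)"
    unfolding serre_mat_def
    apply (simp only: kron_mult[of _ m _ n] car cl W P_def[symmetric] Q_def[symmetric] R_def[symmetric] T_def[symmetric])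
    apply (rule kron_eqI[of _ m n])
    using car c *** by (auto simp: kron_index[of _ m _ n])
  show "serre_mat q (kron G A) (kron H B)"
    unfolding serre_mat_def
    apply (simp only: kron_mult[of _ n _ m] car cl W P_def[symmetric] Q_def[symmetric] R_def[symmetric] T_def[symmetric])
    apply (rule kron_eqI[of _ n m])
    using car c ** by (auto simp: kron_index[of _ n _ m])
qed

lemma comm_kron:
  fixes e f g D1 D2 K e' f' D1' D2' :: "complex mat"
  assumes car: "e \<in> carrier_mat m m" "f \<in> carrier_mat m m" "g \<in> carrier_mat m m" "D1 \<in> carrier_mat m m" "D2 \<in> carrier_mat m m"
    "K \<in> carrier_mat n n" "e' \<in> carrier_mat n n" "f' \<in> carrier_mat n n" "D1' \<in> carrier_mat n n" "D2' \<in> carrier_mat n n"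
   and r: "e * f + D1 = f * e + D2" "e' * f' + D1' = f' * e' + D2'"
   and c: "e * g = c \<cdot>\<^sub>m (g * e)" "K * f' = d \<cdot>\<^sub>m (f' * K)" "c * d = 1"
  shows "(kron e K + kron (1\<^sub>m m) e') * (kron f (1\<^sub>m n) + kron g f') + (kron D1 K + kron g D1')
    = (kron f (1\<^sub>m n) + kron g f') * (kron e K + kron (1\<^sub>m m) e') + (kron D2 K + kron g D2')"
proof -
  note cl = mult_carrier_mat[of _ m m _ m] mult_carrier_mat[of _ n n _ n] one_carrier_mat kron_carrier
  let ?N = "m * n"
  have dd: "(S + T) * (U + V) = S * U + S * V + (T * U + T * V)" if "S \<in> carrier_mat ?N ?N" "T \<in> carrier_mat ?N ?N"
     "U \<in> carrier_mat ?N ?N" "V \<in> carrier_mat ?N ?N" for S T U V :: "complex mat"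
    using that by (simp add: add_mult_distrib_mat[of S ?N ?N T "U + V" ?N]) (simp add: mult_add_distrib_mat[of _ ?N ?N _ ?N])
  have k1: "(e * f) $$ (i, j) = (f * e) $$ (i, j) + D2 $$ (i, j) - D1 $$ (i, j)" if "i < m" "j < m" for i j
  proof -
    have "(e * f + D1) $$ (i, j) = (f * e + D2) $$ (i, j)" by (simp only: r)
    then show ?thesis using that car by (simp del: index_mult_mat(1) add: algebra_simps)
  qed
  have k2: "(e' * f') $$ (i, j) = (f' * e') $$ (i, j) + D2' $$ (i, j) - D1' $$ (i, j)" if "i < n" "j < n" for i j
  proof -
    have "(e' * f' + D1') $$ (i, j) = (f' * e' + D2') $$ (i, j)" by (simp only: r)
    then show ?thesis using that car by (simp del: index_mult_mat(1) add: algebra_simps)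
  qed
  have cd: "c * (x * (d * y)) = x * y" for x y using c(3) by (metis mult.assoc mult.commute mult.left_neutral)
  have o: "f * 1\<^sub>m m = f" "1\<^sub>m m * f = f" "1\<^sub>m m * g = g" "g * 1\<^sub>m m = g" "K * 1\<^sub>m n = K" "1\<^sub>m n * K = K"  "e' * 1\<^sub>m n = e'" "1\<^sub>m n * e' = e'"
    using car by auto
  show ?thesis
    apply (subst dd) apply (simp_all add: car cl)
    apply (subst dd) apply (simp_all add: car cl)
    apply (simp add: kron_mult[of _ m _ n] car cl o c(1,2))
    apply (rule kron_eqI[of _ m n])
    apply (simp_all add: car cl)
    using car by (simp del: index_mult_mat(1) add: cl kron_index[of _ m _ n] k1 k2 algebra_simps cd c(3))
qed

lemma U_module_rels:
  assumes M: "U_module q M" and q: "q \<noteq> 0"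
  defines "E0' \<equiv> gmat M E0" and "E1' \<equiv> gmat M E1" and "F0' \<equiv> gmat M F0" and "F1' \<equiv> gmat M F1"
    and "k \<equiv> gmat M Kp" and "k' \<equiv> gmat M Km" and "s \<equiv> 1 / (q - 1 / q)"
  shows "k * k' = 1\<^sub>m (udim M)" "k' * k = 1\<^sub>m (udim M)"
    "k * E1' = q^2 \<cdot>\<^sub>m (E1' * k)" "k * F1' = (1 / q^2) \<cdot>\<^sub>m (F1' * k)"
    "k * E0' = (1 / q^2) \<cdot>\<^sub>m (E0' * k)" "k * F0' = q^2 \<cdot>\<^sub>m (F0' * k)"
    "E1' * k' = q^2 \<cdot>\<^sub>m (k' * E1')" "F1' * k' = (1 / q^2) \<cdot>\<^sub>m (k' * F1')"
    "E0' * k' = (1 / q^2) \<cdot>\<^sub>m (k' * E0')" "F0' * k' = q^2 \<cdot>\<^sub>m (k' * F0')"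
    "E1' * F1' + s \<cdot>\<^sub>m k' = F1' * E1' + s \<cdot>\<^sub>m k"
    "E0' * F0' + s \<cdot>\<^sub>m k = F0' * E0' + s \<cdot>\<^sub>m k'"
    "E1' * F0' = F0' * E1'" "E0' * F1' = F1' * E0'"
    "serre_mat q E0' E1'" "serre_mat q E1' E0'" "serre_mat q F0' F1'" "serre_mat q F1' F0'"
proof -
  let ?n = "udim M"
  have c: "\<And>g. gmat M g \<in> carrier_mat ?n ?n" and eq: "\<And>x y. (x, y) \<in> U_relations q \<Longrightarrow> act M x = act M y"
    using M by (auto simp: U_module_def intro: U_eq.rel)
  note car = c[of E0, folded E0'_def] c[of E1, folded E1'_def] c[of F0, folded F0'_def] c[of F1, folded F1'_def]
    c[of Kp, folded k_def] c[of Km, folded k'_def]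
  note gm = E0'_def[symmetric] E1'_def[symmetric] F0'_def[symmetric] F1'_def[symmetric] k_def[symmetric] k'_def[symmetric]
  note U = U_relations_def Let_def
  have one: "(a \<cdot>\<^sub>m 1\<^sub>m ?n) * A = a \<cdot>\<^sub>m A" if "A \<in> carrier_mat ?n ?n" for a :: complex and A
    using that by (simp add: mult_smult_assoc_mat[of _ ?n ?n _ ?n])
  show kk: "k * k' = 1\<^sub>m (udim M)" "k' * k = 1\<^sub>m (udim M)"
    using eq[of "Gen Kp * Gen Km" "Scal 1"] eq[of "Gen Km * Gen Kp" "Scal 1"] by (auto simp: U gm)
  have conj: "k * A = a \<cdot>\<^sub>m (A * k)" "A * k' = a \<cdot>\<^sub>m (k' * A)"
    if A: "A \<in> carrier_mat ?n ?n" and e: "k * A * k' = (a \<cdot>\<^sub>m 1\<^sub>m ?n) * A" for a :: complex and A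
  proof -
    have e': "k * A * k' = a \<cdot>\<^sub>m A" using e one[OF A] by simp
    have "k * A = k * A * (k' * k)" using A car kk by simp
    also have "\<dots> = k * A * k' * k" using A car by (simp add: assoc_mult_mat[of _ ?n ?n _ ?n _ ?n])
    also have "\<dots> = a \<cdot>\<^sub>m (A * k)" unfolding e' using A car by (simp add: mult_smult_assoc_mat[of _ ?n ?n _ ?n])
    finally show "k * A = a \<cdot>\<^sub>m (A * k)" .
    have "A * k' = k' * k * (A * k')" using A car kk by simp
    also have "\<dots> = k' * (k * A * k')" using A car by (simp add: assoc_mult_mat[of _ ?n ?n _ ?n _ ?n])
    also have "\<dots> = a \<cdot>\<^sub>m (k' * A)" unfolding e' using A car by (simp add: mult_smult_distrib[of _ ?n ?n _ ?n])
    finally show "A * k' = a \<cdot>\<^sub>m (k' * A)" .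
  qed
  have 1: "k * E1' * k' = (q^2 \<cdot>\<^sub>m 1\<^sub>m ?n) * E1'" "k * F1' * k' = ((1 / q^2) \<cdot>\<^sub>m 1\<^sub>m ?n) * F1'"
    "k * E0' * k' = ((1 / q^2) \<cdot>\<^sub>m 1\<^sub>m ?n) * E0'" "k * F0' * k' = (q^2 \<cdot>\<^sub>m 1\<^sub>m ?n) * F0'"
    using eq[of "Gen Kp * Gen E1 * Gen Km" "Scal (q^2) * Gen E1"] eq[of "Gen Kp * Gen F1 * Gen Km" "Scal (1/q^2) * Gen F1"]
      eq[of "Gen Kp * Gen E0 * Gen Km" "Scal (1/q^2) * Gen E0"] eq[of "Gen Kp * Gen F0 * Gen Km" "Scal (q^2) * Gen F0"]
    by (auto simp: U gm)
  show "k * E1' = q^2 \<cdot>\<^sub>m (E1' * k)" "k * F1' = (1 / q^2) \<cdot>\<^sub>m (F1' * k)"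
    "k * E0' = (1 / q^2) \<cdot>\<^sub>m (E0' * k)" "k * F0' = q^2 \<cdot>\<^sub>m (F0' * k)"
    "E1' * k' = q^2 \<cdot>\<^sub>m (k' * E1')" "F1' * k' = (1 / q^2) \<cdot>\<^sub>m (k' * F1')"
    "E0' * k' = (1 / q^2) \<cdot>\<^sub>m (k' * E0')" "F0' * k' = q^2 \<cdot>\<^sub>m (k' * F0')"
    by (rule conj; (rule car 1))+
  show "serre_mat q E0' E1'" "serre_mat q E1' E0'" "serre_mat q F0' F1'" "serre_mat q F1' F0'"
    using act_serre[of M q "Gen E0" "Gen E1"] act_serre[of M q "Gen E1" "Gen E0"] act_serre[of M q "Gen F0" "Gen F1"] act_serre[of M q "Gen F1" "Gen F0"]
      eq[of "serre q (Gen E0) (Gen E1)" "Scal 0"] eq[of "serre q (Gen E1) (Gen E0)" "Scal 0"]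
      eq[of "serre q (Gen F0) (Gen F1)" "Scal 0"] eq[of "serre q (Gen F1) (Gen F0)" "Scal 0"] c
    by (simp_all add: U gm)
  have com: "A * B + s \<cdot>\<^sub>m D = B * A + s \<cdot>\<^sub>m C" if "A * B + ((-1) \<cdot>\<^sub>m 1\<^sub>m ?n) * (B * A) = s \<cdot>\<^sub>m C + (-s) \<cdot>\<^sub>m D"
    "A \<in> carrier_mat ?n ?n" "B \<in> carrier_mat ?n ?n" "C \<in> carrier_mat ?n ?n" "D \<in> carrier_mat ?n ?n" for A B C D :: "complex mat"
  proof (rule eq_matI)
    fix i j assume "i < dim_row (B * A + s \<cdot>\<^sub>m C)" "j < dim_col (B * A + s \<cdot>\<^sub>m C)"
    then have "i < ?n" "j < ?n" using that by auto
    then show "(A * B + s \<cdot>\<^sub>m D) $$ (i, j) = (B * A + s \<cdot>\<^sub>m C) $$ (i, j)"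
      using arg_cong[OF that(1)[unfolded one[OF mult_carrier_mat[OF that(3,2)]]], of "\<lambda>M. M $$ (i, j)"] that(2-)
      by (simp del: index_mult_mat(1) add: algebra_simps)
  qed (use that in auto)
  have z: "((s \<cdot>\<^sub>m 1\<^sub>m ?n) * (k + ((-1) \<cdot>\<^sub>m 1\<^sub>m ?n) * k')) = s \<cdot>\<^sub>m k + (-s) \<cdot>\<^sub>m k'"
    "((-1) \<cdot>\<^sub>m 1\<^sub>m ?n) * ((s \<cdot>\<^sub>m 1\<^sub>m ?n) * (k + ((-1) \<cdot>\<^sub>m 1\<^sub>m ?n) * k')) = s \<cdot>\<^sub>m k' + (-s) \<cdot>\<^sub>m k"
    "((-1) \<cdot>\<^sub>m 1\<^sub>m ?n) * k = (-1) \<cdot>\<^sub>m k" "((-1) \<cdot>\<^sub>m 1\<^sub>m ?n) * k' = (-1) \<cdot>\<^sub>m k'"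
    using car by (auto simp: one intro!: eq_matI simp: algebra_simps)
  show "E1' * F1' + s \<cdot>\<^sub>m k' = F1' * E1' + s \<cdot>\<^sub>m k"
    using eq[of "commutator (Gen E1) (Gen F1)" "Scal s * (Gen Kp - Gen Km)"] z
    by (intro com car) (simp add: U gm s_def[symmetric] commutator_def)
  show "E0' * F0' + s \<cdot>\<^sub>m k = F0' * E0' + s \<cdot>\<^sub>m k'"
    using eq[of "commutator (Gen E0) (Gen F0)" "Scal (-1) * (Scal s * (Gen Kp - Gen Km))"] z
    by (intro com car) (simp add: U gm s_def[symmetric] commutator_def)
  have com0: "A * B = B * A" if "A * B + ((-1) \<cdot>\<^sub>m 1\<^sub>m ?n) * (B * A) = 0 \<cdot>\<^sub>m 1\<^sub>m ?n"
    "A \<in> carrier_mat ?n ?n" "B \<in> carrier_mat ?n ?n" for A B :: "complex mat"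
  proof (rule eq_matI)
    fix i j assume "i < dim_row (B * A)" "j < dim_col (B * A)"
    then have "i < ?n" "j < ?n" using that by auto
    then show "(A * B) $$ (i, j) = (B * A) $$ (i, j)"
      using arg_cong[OF that(1)[unfolded one[OF mult_carrier_mat[OF that(3,2)]]], of "\<lambda>M. M $$ (i, j)"] that(2-)
      by (simp del: index_mult_mat(1))
  qed (use that in auto)
  show "E1' * F0' = F0' * E1'"
    using eq[of "commutator (Gen E1) (Gen F0)" "Scal 0"] 
    by (intro com0 car) (simp add: U gm commutator_def)
  show "E0' * F1' = F1' * E0'"
    using eq[of "commutator (Gen E0) (Gen F1)" "Scal 0"] 
    by (intro com0 car) (simp add: U gm commutator_def)
qed

lemma U_moduleI2:
  fixes M :: umod
  defines "e0 \<equiv> gmat M E0" and "e1 \<equiv> gmat M E1" and "f0 \<equiv> gmat M F0" and "f1 \<equiv> gmat M F1"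
    and "k \<equiv> gmat M Kp" and "k' \<equiv> gmat M Km" and "s \<equiv> \<lambda>q. 1 / (q - 1 / q)"
  assumes c: "\<And>g. gmat M g \<in> carrier_mat (udim M) (udim M)"
   and r: "k * k' = 1\<^sub>m (udim M)" "k' * k = 1\<^sub>m (udim M)"
    "k * e1 = q^2 \<cdot>\<^sub>m (e1 * k)" "k * f1 = (1 / q^2) \<cdot>\<^sub>m (f1 * k)"
    "k * e0 = (1 / q^2) \<cdot>\<^sub>m (e0 * k)" "k * f0 = q^2 \<cdot>\<^sub>m (f0 * k)"
    "e1 * f1 + s q \<cdot>\<^sub>m k' = f1 * e1 + s q \<cdot>\<^sub>m k"
    "e0 * f0 + s q \<cdot>\<^sub>m k = f0 * e0 + s q \<cdot>\<^sub>m k'"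
    "e1 * f0 = f0 * e1" "e0 * f1 = f1 * e0"
    "serre_mat q e0 e1" "serre_mat q e1 e0" "serre_mat q f0 f1" "serre_mat q f1 f0"
  shows "U_module q M"
proof (rule U_moduleI)
  show "gmat M g \<in> carrier_mat (udim M) (udim M)" for g by (rule c)
  fix x y assume xy: "(x, y) \<in> U_relations q"
  let ?n = "udim M"
  note car = c[of E0, folded e0_def] c[of E1, folded e1_def] c[of F0, folded f0_def] c[of F1, folded f1_def]
    c[of Kp, folded k_def] c[of Km, folded k'_def]
  note gm = e0_def[symmetric] e1_def[symmetric] f0_def[symmetric] f1_def[symmetric] k_def[symmetric] k'_def[symmetric]
  have one: "(a \<cdot>\<^sub>m 1\<^sub>m ?n) * A = a \<cdot>\<^sub>m A" if "A \<in> carrier_mat ?n ?n" for a :: complex and A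
    using that by (simp add: mult_smult_assoc_mat[of _ ?n ?n _ ?n])
  have conj: "k * A * k' = (a \<cdot>\<^sub>m 1\<^sub>m ?n) * A" if "k * A = a \<cdot>\<^sub>m (A * k)" "A \<in> carrier_mat ?n ?n" for a :: complex and A
  proof -
    have "k * A * k' = a \<cdot>\<^sub>m (A * k * k')" unfolding that(1) using that(2) car by (simp add: mult_smult_assoc_mat[of _ ?n ?n _ ?n])
    also have "A * k * k' = A" using that(2) car r by (simp add: assoc_mult_mat[of _ ?n ?n _ ?n _ ?n])
    finally show ?thesis using one[OF that(2)] by simp
  qed
  have com: "A * B + ((-1) \<cdot>\<^sub>m 1\<^sub>m ?n) * (B * A) = (s q \<cdot>\<^sub>m 1\<^sub>m ?n) * (C + ((-1) \<cdot>\<^sub>m 1\<^sub>m ?n) * D)"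
    "A * B + ((-1) \<cdot>\<^sub>m 1\<^sub>m ?n) * (B * A) = ((-1) \<cdot>\<^sub>m 1\<^sub>m ?n) * ((s q \<cdot>\<^sub>m 1\<^sub>m ?n) * (D + ((-1) \<cdot>\<^sub>m 1\<^sub>m ?n) * C))"
    if "A * B + s q \<cdot>\<^sub>m D = B * A + s q \<cdot>\<^sub>m C"
    "A \<in> carrier_mat ?n ?n" "B \<in> carrier_mat ?n ?n" "C \<in> carrier_mat ?n ?n" "D \<in> carrier_mat ?n ?n" for A B C D
  proof -
    note cs = that(2-) mult_carrier_mat[OF that(2,3)] mult_carrier_mat[OF that(3,2)] add_carrier_mat smult_carrier_mat
    have e: "(A * B) $$ (i, j) = (B * A) $$ (i, j) + s q * C $$ (i, j) - s q * D $$ (i, j)" if "i < ?n" "j < ?n" for i j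
    proof -
      have "(A * B + s q \<cdot>\<^sub>m D) $$ (i, j) = (B * A + s q \<cdot>\<^sub>m C) $$ (i, j)" by (simp only: \<open>A * B + _ = _\<close>)
      then show ?thesis using that cs by (simp del: index_mult_mat(1) add: algebra_simps)
    qed
    show "A * B + ((-1) \<cdot>\<^sub>m 1\<^sub>m ?n) * (B * A) = (s q \<cdot>\<^sub>m 1\<^sub>m ?n) * (C + ((-1) \<cdot>\<^sub>m 1\<^sub>m ?n) * D)"
      apply (simp only: one cs)
      by (rule eq_matI) (use cs e in \<open>simp_all del: index_mult_mat(1) add: algebra_simps\<close>)
    show "A * B + ((-1) \<cdot>\<^sub>m 1\<^sub>m ?n) * (B * A) = ((-1) \<cdot>\<^sub>m 1\<^sub>m ?n) * ((s q \<cdot>\<^sub>m 1\<^sub>m ?n) * (D + ((-1) \<cdot>\<^sub>m 1\<^sub>m ?n) * C))"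
      apply (simp only: one cs)
      by (rule eq_matI) (use cs e in \<open>simp_all del: index_mult_mat(1) add: algebra_simps\<close>)
  qed
  have com0: "B * A + ((-1) \<cdot>\<^sub>m 1\<^sub>m ?n) * (B * A) = 0 \<cdot>\<^sub>m 1\<^sub>m ?n"
    if "A \<in> carrier_mat ?n ?n" "B \<in> carrier_mat ?n ?n" for A B :: "complex mat"
    unfolding one[OF mult_carrier_mat[OF that(2,1)]]
    by (rule eq_matI) (use that in \<open>simp_all del: index_mult_mat(1)\<close>)
  note S = act_serre[of M, OF c]
  have s1: "1 \<cdot>\<^sub>m 1\<^sub>m ?n = (1\<^sub>m ?n :: complex mat)" by (rule eq_matI) auto
  show "act M x = act M y"
    using xy unfolding U_relations_def Let_def
    apply (elim insertE emptyE; simp only: prod.inject; elim conjE; hypsubst)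
    subgoal by (simp add: gm r s1)
    subgoal by (simp add: gm r s1)
    subgoal by (simp add: gm conj[OF r(3) car(2)])
    subgoal by (simp add: gm conj[OF r(4) car(4)])
    subgoal by (simp add: gm conj[OF r(5) car(1)])
    subgoal by (simp add: gm conj[OF r(6) car(3)])
    subgoal using com(1)[OF r(7) car(2,4,5,6)] by (simp add: gm commutator_def s_def)
    subgoal using com(2)[OF r(8) car(1,3,6,5)] by (simp add: gm commutator_def s_def)
    subgoal using com0[OF car(2,3)] by (simp add: gm commutator_def r)
    subgoal using com0[OF car(1,4)] by (simp add: gm commutator_def r)
    by (simp_all only: S act.simps(1) gm r)
qed

lemma serre_tensor:
  assumes q: "q \<noteq> 0"
   and car: "x \<in> carrier_mat m m" "x' \<in> carrier_mat m m" "g \<in> carrier_mat n n" "g' \<in> carrier_mat n n"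
     "y \<in> carrier_mat n n" "y' \<in> carrier_mat n n"
   and gg: "g * g' = 1\<^sub>m n" "g' * g = 1\<^sub>m n"
   and r: "g * y = q^2 \<cdot>\<^sub>m (y * g)" "g * y' = (1/q^2) \<cdot>\<^sub>m (y' * g)" "g' * y = (1/q^2) \<cdot>\<^sub>m (y * g')" "g' * y' = q^2 \<cdot>\<^sub>m (y' * g')"
   and S: "serre_mat q x x'" "serre_mat q y y'"
  shows "serre_mat q (kron x g + kron (1\<^sub>m m) y) (kron x' g' + kron (1\<^sub>m m) y')" 
     "serre_mat q (kron g x + kron y (1\<^sub>m m)) (kron g' x' + kron y' (1\<^sub>m m))" 
proof -
  have W: "g * (g * (g * g')) = g * g" "g * (g' * (g * g)) = g * g" "g * (g * (g' * g)) = g * g" "g' * (g * (g * g)) = g * g"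
  proof -
    have "g' * (g * (g * g)) = g' * g * (g * g)" "g * (g' * (g * g)) = g * (g' * g * g)" using car by (simp_all add: assoc_mult_mat[of _ n n _ n _ n])
    then show "g * (g * (g * g')) = g * g" "g * (g' * (g * g)) = g * g" "g * (g * (g' * g)) = g * g" "g' * (g * (g * g)) = g * g"
      using gg car by simp_all
  qed
  note c' = car one_carrier_mat[of m]
  have o: "x * 1\<^sub>m m = x" "1\<^sub>m m * x = x" "x' * 1\<^sub>m m = x'" "1\<^sub>m m * x' = x'" using car by auto
  note sk1 = serre_kron[OF car(1,2,3,4) mult_carrier_mat[OF car(3,3)] S(1) W]
  have 1: "(1\<^sub>m m * (1\<^sub>m m * (1\<^sub>m m * 1\<^sub>m m))) = (1\<^sub>m m :: complex mat)" by simp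
  note sk2 = serre_kron[OF car(5,6) one_carrier_mat one_carrier_mat one_carrier_mat S(2) 1 1 1 1]
  note cl = mult_carrier_mat[OF car(3) car(5)] mult_carrier_mat[OF car(3) car(6)] mult_carrier_mat[OF car(4) car(5)] mult_carrier_mat[OF car(4) car(6)]
     mult_carrier_mat[OF car(5) car(3)] mult_carrier_mat[OF car(6) car(3)] mult_carrier_mat[OF car(5) car(4)] mult_carrier_mat[OF car(6) car(4)]
  show "serre_mat q (kron x g + kron (1\<^sub>m m) y) (kron x' g' + kron (1\<^sub>m m) y')" 
    by (rule serre_mat_add[of _ "m * n", OF _ _ _ _ q _ _ _ _ sk1(1) sk2(2)])
     (simp_all add: kron_mult[of _ m _ n] c' o r kron_smult(2)[of _ m _ n] cl)
  show "serre_mat q (kron g x + kron y (1\<^sub>m m)) (kron g' x' + kron y' (1\<^sub>m m))" 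
    by (rule serre_mat_add[of _ "n * m", OF _ _ _ _ q _ _ _ _ sk1(2) sk2(1)])
     (simp_all add: kron_mult[of _ n _ m] c' o r kron_smult(1)[of _ n _ m] cl)
qed

lemma U_module_tensor:
  assumes q: "q \<noteq> 0" and M: "U_module q M" and N: "U_module q N"
  shows "U_module q (tensor_module M N)"
proof -
  let ?m = "udim M" let ?n = "udim N"
  have cM: "gmat M g \<in> carrier_mat ?m ?m" for g using M by (simp add: U_module_def)
  have cN: "gmat N g \<in> carrier_mat ?n ?n" for g using N by (simp add: U_module_def)
  note RM = U_module_rels[OF M q] and RN = U_module_rels[OF N q]
  have T: "udim (tensor_module M N) = ?m * ?n" "gmat (tensor_module M N) = tensor_gmat M N"
    by (simp_all add: tensor_module_def)
  have c: "gmat (tensor_module M N) g \<in> carrier_mat (udim (tensor_module M N)) (udim (tensor_module M N))" for g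
    unfolding T by (cases g) (simp_all add: cM cN)
  note o = left_mult_one_mat[OF cM] left_mult_one_mat[OF cN] right_mult_one_mat[OF cM] right_mult_one_mat[OF cN]
  have q2: "q^2 * (1 / q^2) = 1" "1 / q^2 * q^2 = 1" using q by simp_all
  let ?N = "?m * ?n"
  have kc: "kron A B \<in> carrier_mat ?N ?N" if "A \<in> carrier_mat ?m ?m" "B \<in> carrier_mat ?n ?n" for A B using that by simp
  have sw: "kron A B + kron C D = kron C D + kron A B" if "A \<in> carrier_mat ?m ?m" "B \<in> carrier_mat ?n ?n" 
    "C \<in> carrier_mat ?m ?m" "D \<in> carrier_mat ?n ?n" for A B C D
    by (rule comm_add_mat; rule kc; rule that)
  have kk: "kron (gmat M Kp) (gmat N Kp) * (kron A B + kron C D) = a \<cdot>\<^sub>m ((kron A B + kron C D) * kron (gmat M Kp) (gmat N Kp))"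
    if cs: "A \<in> carrier_mat ?m ?m" "B \<in> carrier_mat ?n ?n" "C \<in> carrier_mat ?m ?m" "D \<in> carrier_mat ?n ?n"
     and e: "kron (gmat M Kp * A) (gmat N Kp * B) = a \<cdot>\<^sub>m kron (A * gmat M Kp) (B * gmat N Kp)"
       "kron (gmat M Kp * C) (gmat N Kp * D) = a \<cdot>\<^sub>m kron (C * gmat M Kp) (D * gmat N Kp)" for A B C D a
    using kc[OF cM cN] kc cs 
    by (simp add: mult_add_distrib_mat[of _ ?N ?N _ ?N] add_mult_distrib_mat[of _ ?N ?N _ _ ?N]
       kron_mult[of _ ?m _ ?n] cM cN e add_smult_distrib_left_mat[of _ ?N ?N])
  have kcl: "kron (A * A') (B * B') \<in> carrier_mat ?N ?N" if "A \<in> carrier_mat ?m ?m" "B \<in> carrier_mat ?n ?n" 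
    "A' \<in> carrier_mat ?m ?m" "B' \<in> carrier_mat ?n ?n" for A B A' B' using that by simp
  have cancel: "P + Y = P' + Z" if "P + (X + Y) = P' + (Z + X)" "P \<in> carrier_mat ?N ?N" "P' \<in> carrier_mat ?N ?N"
    "X \<in> carrier_mat ?N ?N" "Y \<in> carrier_mat ?N ?N" "Z \<in> carrier_mat ?N ?N" for P P' X Y Z :: "complex mat"
  proof (rule eq_matI)
    fix i j assume "i < dim_row (P' + Z)" "j < dim_col (P' + Z)"
    then have "i < ?N" "j < ?N" using that by auto
    then show "(P + Y) $$ (i, j) = (P' + Z) $$ (i, j)"
      using arg_cong[OF that(1), of "\<lambda>M. M $$ (i, j)"] that(2-) by (simp add: algebra_simps)
  qed (use that in auto)
  have z: "A + 0\<^sub>m n n = A" if "A \<in> carrier_mat n n" for A :: "complex mat" and n using that by auto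
  have kz: "kron (0\<^sub>m ?m ?m) A + kron B (0\<^sub>m ?n ?n) = 0\<^sub>m ?N ?N" if "A \<in> carrier_mat ?n ?n" "B \<in> carrier_mat ?m ?m" for A B
    by (rule kron_eqI[of _ ?m ?n]) (use that in \<open>simp_all add: kron_index[of _ ?m _ ?n]\<close>)
  have flip: "B = (1 / q^2) \<cdot>\<^sub>m A" if "A = q^2 \<cdot>\<^sub>m B" for A B :: "complex mat"
    unfolding that using q by (intro eq_matI) auto
  have flip': "B = q^2 \<cdot>\<^sub>m A" if "A = (1 / q^2) \<cdot>\<^sub>m B" for A B :: "complex mat"
    unfolding that using q by (intro eq_matI) auto
  note FM = flip[OF RM(3)] flip'[OF RM(4)] flip'[OF RM(5)] flip[OF RM(6)] flip[OF RM(7)] flip'[OF RM(8)] flip'[OF RM(9)] flip[OF RM(10)]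
  note FN = flip[OF RN(3)] flip'[OF RN(4)] flip'[OF RN(5)] flip[OF RN(6)] flip[OF RN(7)] flip'[OF RN(8)] flip'[OF RN(9)] flip[OF RN(10)]
  let ?s = "1 / (q - 1 / q)"
  show ?thesis
  proof (rule U_moduleI2[OF c, of q], unfold T tensor_gmat.simps)
    show "kron (gmat M Kp) (gmat N Kp) * kron (gmat M Km) (gmat N Km) = 1\<^sub>m ?N"
       "kron (gmat M Km) (gmat N Km) * kron (gmat M Kp) (gmat N Kp) = 1\<^sub>m ?N"
      by (simp_all add: kron_mult[of _ ?m _ ?n] cM cN RM RN kron_one)
    show "serre_mat q (kron (gmat M E0) (gmat N Km) + kron (1\<^sub>m ?m) (gmat N E0)) (kron (gmat M E1) (gmat N Kp) + kron (1\<^sub>m ?m) (gmat N E1))"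
      by (rule serre_tensor(1)[OF q]; rule cM cN RM RN FM FN)
    show "serre_mat q (kron (gmat M E1) (gmat N Kp) + kron (1\<^sub>m ?m) (gmat N E1)) (kron (gmat M E0) (gmat N Km) + kron (1\<^sub>m ?m) (gmat N E0))"
      by (rule serre_tensor(1)[OF q]; rule cM cN RM RN FM FN)
    note sw' = sw[OF cM one_carrier_mat cM cN]
    show "serre_mat q (kron (gmat M F0) (1\<^sub>m ?n) + kron (gmat M Kp) (gmat N F0)) (kron (gmat M F1) (1\<^sub>m ?n) + kron (gmat M Km) (gmat N F1))"
      unfolding sw' by (rule serre_tensor(2)[OF q]; rule cM cN RM RN FM FN)
    show "serre_mat q (kron (gmat M F1) (1\<^sub>m ?n) + kron (gmat M Km) (gmat N F1)) (kron (gmat M F0) (1\<^sub>m ?n) + kron (gmat M Kp) (gmat N F0))"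
      unfolding sw' by (rule serre_tensor(2)[OF q]; rule cM cN RM RN FM FN)
    note ks = kron_smult[of _ ?m _ ?n]
    note oc = one_carrier_mat
    show "kron (gmat M Kp) (gmat N Kp) * (kron (gmat M E1) (gmat N Kp) + kron (1\<^sub>m ?m) (gmat N E1)) =
      q^2 \<cdot>\<^sub>m ((kron (gmat M E1) (gmat N Kp) + kron (1\<^sub>m ?m) (gmat N E1)) * kron (gmat M Kp) (gmat N Kp))"
      by (rule kk[OF cM cN oc cN]) (simp_all add: RM RN ks cM cN o mult_carrier_mat[OF cM cM] mult_carrier_mat[OF cN cN])
    show "kron (gmat M Kp) (gmat N Kp) * (kron (gmat M E0) (gmat N Km) + kron (1\<^sub>m ?m) (gmat N E0)) =
      (1 / q^2) \<cdot>\<^sub>m ((kron (gmat M E0) (gmat N Km) + kron (1\<^sub>m ?m) (gmat N E0)) * kron (gmat M Kp) (gmat N Kp))"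
      by (rule kk[OF cM cN oc cN]) (simp_all add: RM RN ks cM cN o mult_carrier_mat[OF cM cM] mult_carrier_mat[OF cN cN])
    show "kron (gmat M Kp) (gmat N Kp) * (kron (gmat M F1) (1\<^sub>m ?n) + kron (gmat M Km) (gmat N F1)) =
      (1 / q^2) \<cdot>\<^sub>m ((kron (gmat M F1) (1\<^sub>m ?n) + kron (gmat M Km) (gmat N F1)) * kron (gmat M Kp) (gmat N Kp))"
      by (rule kk[OF cM oc cM cN]) (simp_all add: RM RN ks cM cN o mult_carrier_mat[OF cM cM] mult_carrier_mat[OF cN cN])
    show "kron (gmat M Kp) (gmat N Kp) * (kron (gmat M F0) (1\<^sub>m ?n) + kron (gmat M Kp) (gmat N F0)) =
      q^2 \<cdot>\<^sub>m ((kron (gmat M F0) (1\<^sub>m ?n) + kron (gmat M Kp) (gmat N F0)) * kron (gmat M Kp) (gmat N Kp))"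
      by (rule kk[OF cM oc cM cN]) (simp_all add: RM RN ks cM cN o mult_carrier_mat[OF cM cM] mult_carrier_mat[OF cN cN])
    have s: "s \<cdot>\<^sub>m A \<in> carrier_mat n n" if "A \<in> carrier_mat n n" for s A n using that by simp
    have cc: "(A + B) * (C + D) \<in> carrier_mat ?N ?N" if "A \<in> carrier_mat ?N ?N" "B \<in> carrier_mat ?N ?N" "C \<in> carrier_mat ?N ?N" "D \<in> carrier_mat ?N ?N" for A B C D
      using that by auto
    show "(kron (gmat M E1) (gmat N Kp) + kron (1\<^sub>m ?m) (gmat N E1)) * (kron (gmat M F1) (1\<^sub>m ?n) + kron (gmat M Km) (gmat N F1)) + ?s \<cdot>\<^sub>m kron (gmat M Km) (gmat N Km) =
      (kron (gmat M F1) (1\<^sub>m ?n) + kron (gmat M Km) (gmat N F1)) * (kron (gmat M E1) (gmat N Kp) + kron (1\<^sub>m ?m) (gmat N E1)) + ?s \<cdot>\<^sub>m kron (gmat M Kp) (gmat N Kp)"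
      by (rule cancel[OF comm_kron[OF cM cM cM s[OF cM] s[OF cM] cN cN cN s[OF cN] s[OF cN] RM(11) RN(11) RM(7) RN(4) q2(1), unfolded ks(1)[OF cM cN] ks(2)[OF cM cN]]])
        (intro cc s kc cM cN oc)+
    show "(kron (gmat M E0) (gmat N Km) + kron (1\<^sub>m ?m) (gmat N E0)) * (kron (gmat M F0) (1\<^sub>m ?n) + kron (gmat M Kp) (gmat N F0)) + ?s \<cdot>\<^sub>m kron (gmat M Kp) (gmat N Kp) =
      (kron (gmat M F0) (1\<^sub>m ?n) + kron (gmat M Kp) (gmat N F0)) * (kron (gmat M E0) (gmat N Km) + kron (1\<^sub>m ?m) (gmat N E0)) + ?s \<cdot>\<^sub>m kron (gmat M Km) (gmat N Km)"
      by (rule cancel[OF comm_kron[OF cM cM cM s[OF cM] s[OF cM] cN cN cN s[OF cN] s[OF cN] RM(12) RN(12) FM(3) FN(8) q2(1), unfolded ks(1)[OF cM cN] ks(2)[OF cM cN]]])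
        (intro cc s kc cM cN oc)+
    have pz: "P = P'" if "P + (kron (0\<^sub>m ?m ?m) A + kron B (0\<^sub>m ?n ?n)) = P' + (kron (0\<^sub>m ?m ?m) A + kron B (0\<^sub>m ?n ?n))"
      "A \<in> carrier_mat ?n ?n" "B \<in> carrier_mat ?m ?m" "P \<in> carrier_mat ?N ?N" "P' \<in> carrier_mat ?N ?N" for P P' A B
      using that(1) unfolding kz[OF that(2,3)] z[OF that(4)] z[OF that(5)] .
    have m0: "A * B + 0\<^sub>m n n = B * A + 0\<^sub>m n n" if "A * B = B * A" for A B :: "complex mat" and n using that by simp
    show "(kron (gmat M E1) (gmat N Kp) + kron (1\<^sub>m ?m) (gmat N E1)) * (kron (gmat M F0) (1\<^sub>m ?n) + kron (gmat M Kp) (gmat N F0)) =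
      (kron (gmat M F0) (1\<^sub>m ?n) + kron (gmat M Kp) (gmat N F0)) * (kron (gmat M E1) (gmat N Kp) + kron (1\<^sub>m ?m) (gmat N E1))"
      by (rule pz[OF comm_kron[OF cM cM cM zero_carrier_mat zero_carrier_mat cN cN cN zero_carrier_mat zero_carrier_mat m0[OF RM(13)] m0[OF RN(13)] FM(1) RN(6) q2(2)]])
        (intro cc s kc cM cN oc)+
    show "(kron (gmat M E0) (gmat N Km) + kron (1\<^sub>m ?m) (gmat N E0)) * (kron (gmat M F1) (1\<^sub>m ?n) + kron (gmat M Km) (gmat N F1)) =
      (kron (gmat M F1) (1\<^sub>m ?n) + kron (gmat M Km) (gmat N F1)) * (kron (gmat M E0) (gmat N Km) + kron (1\<^sub>m ?m) (gmat N E0))"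
      by (rule pz[OF comm_kron[OF cM cM cM zero_carrier_mat zero_carrier_mat cN cN cN zero_carrier_mat zero_carrier_mat m0[OF RM(14)] m0[OF RN(14)] RM(9) FN(6) q2(2)]])
        (intro cc s kc cM cN oc)+
  qed
qed

lemma U_module_word:
  assumes "q \<noteq> 0" "q ^ 2 \<noteq> 1"
  shows "U_module q (word_module q w)"
  by (induction w) (simp_all add: word_module_def U_module_trivial U_module_tensor U_module_eval assms)

lemma word_module_singleton:
  assumes "q \<noteq> 0" "q ^ 2 \<noteq> 1" shows "word_module q [a] = eval_module q a"
  using U_module_eval[OF assms, of a] unfolding U_module_def word_module_def by (simp add: tensor_trivial)

lemma (in vectorspace) subspace_fin_dim_dim:
  assumes W: "subspace K W V" and fd: "fin_dim"
  shows "vectorspace.fin_dim K (vs W)" "vectorspace.dim K (vs W) \<le> dim"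
proof -
  interpret w: vectorspace K "vs W" using W by (rule subspace_is_vs)
  have sm: "submodule K W V" using W by simp
  have li: "finite A \<and> card A \<le> dim" if A: "A \<subseteq> W \<and> w.lin_indpt A" for A
  proof -
    have "A \<subseteq> carrier V" using A sm unfolding submodule_def by blast
    moreover have "lin_indpt A" using span_li_not_depend(2)[OF _ sm, of A] A by blast
    ultimately show ?thesis using li_le_dim[OF fd] by blast
  qed
  have "\<exists>A. finite A \<and> maximal A (\<lambda>S. S \<subseteq> carrier (vs W) \<and> w.lin_indpt S)"
  proof (rule maximal_exists[where B = "{}" and N = "dim"])
    show "finite A \<and> card A \<le> dim" if "A \<subseteq> carrier (vs W) \<and> w.lin_indpt A" for A
      by (rule li) (use that in simp)
    show "{} \<subseteq> carrier (vs W) \<and> w.lin_indpt {}" unfolding w.lin_dep_def by blast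
  qed
  then obtain A where "finite A" "w.basis A" using w.max_li_is_basis by blast
  then show fin: "w.fin_dim" unfolding w.fin_dim_def w.basis_def by blast
  show "w.dim \<le> dim" by (rule subspace_dim[OF W fd fin])
qed

lemma matrix_fin_dim: "vectorspace.fin_dim (class_ring :: complex ring) (module_mat TYPE(complex) r c)"
   "vectorspace.dim (class_ring :: complex ring) (module_mat TYPE(complex) r c) \<le> r * c"
proof -
  let ?V = "module_mat TYPE(complex) r c"
  interpret v: vectorspace "class_ring :: complex ring" ?V by (rule matrix_vs)
  define E where "E x = mat r c (\<lambda>y. if x = y then 1 else 0 :: complex)" for x
  define I where "I = {..<r} \<times> {..<c}"
  have EV: "E ` I \<subseteq> carrier ?V" by (auto simp: E_def module_mat_simps)
  have sub: "submodule class_ring (v.span (E ` I)) ?V" by (rule v.span_is_submodule[OF EV])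
  have mask: "mat r c (\<lambda>y. if y \<in> X then A $$ y else 0) \<in> v.span (E ` I)" if "finite X" "X \<subseteq> I" for X and A :: "complex mat"
    using that
  proof induction
    case empty
    have "mat r c (\<lambda>y. if y \<in> {} then A $$ y else 0) = \<zero>\<^bsub>?V\<^esub>" by (auto simp: module_mat_def)
    then show ?case using sub by (simp add: submodule_def)
  next
    case (insert x X)
    have e: "mat r c (\<lambda>y. if y \<in> insert x X then A $$ y else 0) = (A $$ x \<odot>\<^bsub>?V\<^esub> E x) \<oplus>\<^bsub>?V\<^esub> mat r c (\<lambda>y. if y \<in> X then A $$ y else 0)"
      using insert by (auto simp: module_mat_simps E_def intro!: eq_matI)
    have "E x \<in> v.span (E ` I)" using v.in_own_span[OF EV] insert by blast
    then show ?case unfolding e using sub insert by (auto simp: submodule_def class_ring_simps)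
  qed
  have gen: "v.gen_set (E ` I)"
  proof
    show "v.span (E ` I) \<subseteq> carrier ?V" by (rule v.span_is_subset2[OF EV])
    show "carrier ?V \<subseteq> v.span (E ` I)"
    proof
      fix A assume "A \<in> carrier ?V"
      then have "mat r c (\<lambda>y. if y \<in> I then A $$ y else 0) = A" by (auto simp: module_mat_simps I_def intro!: eq_matI)
      then show "A \<in> v.span (E ` I)" using mask[of I A] by (simp add: I_def)
    qed
  qed
  have fin: "finite (E ` I)" by (simp add: I_def)
  show "v.fin_dim" unfolding v.fin_dim_def using fin EV gen by blast
  have "v.dim \<le> card (E ` I)" unfolding v.dim_def by (rule Least_le) (use fin EV gen in blast)
  also have "\<dots> \<le> r * c" using card_image_le[of I E] by (simp add: I_def)
  finally show "v.dim \<le> r * c" .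
qed

lemma Hom_U_subspace:
  assumes "\<And>g. gmat M g \<in> carrier_mat (udim M) (udim M)" "\<And>g. gmat N g \<in> carrier_mat (udim N) (udim N)"
  shows "subspace class_ring (Hom_U M N) (module_mat TYPE(complex) (udim N) (udim M))"
proof -
  let ?V = "module_mat TYPE(complex) (udim N) (udim M)"
  interpret v: vectorspace "class_ring :: complex ring" ?V by (rule matrix_vs)
  let ?m = "udim M" and ?n = "udim N"
  have a: "act M x \<in> carrier_mat ?m ?m" "act N x \<in> carrier_mat ?n ?n" for x
    by (rule act_carrier, rule assms)+
  have "submodule class_ring (Hom_U M N) ?V"
  proof
    show "Hom_U M N \<subseteq> carrier ?V" by (auto simp: Hom_U_def module_mat_simps)
    show "\<zero>\<^bsub>?V\<^esub> \<in> Hom_U M N"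
      using left_mult_zero_mat[OF a(1)] right_mult_zero_mat[OF a(2)] by (simp add: Hom_U_def module_mat_def)
    fix S T :: "complex mat" and c :: complex
    assume S: "S \<in> Hom_U M N"
    then have cS: "S \<in> carrier_mat ?n ?m" and eS: "S * act M x = act N x * S" for x by (auto simp: Hom_U_def)
    have "(c \<cdot>\<^sub>m S) * act M x = act N x * (c \<cdot>\<^sub>m S)" for x
      using mult_smult_assoc_mat[OF cS a(1)] mult_smult_distrib[OF a(2) cS] eS by simp
    then show "c \<odot>\<^bsub>?V\<^esub> S \<in> Hom_U M N" using cS by (simp add: Hom_U_def module_mat_simps)
    assume T: "T \<in> Hom_U M N"
    then have cT: "T \<in> carrier_mat ?n ?m" and eT: "T * act M x = act N x * T" for x by (auto simp: Hom_U_def)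
    have "(S + T) * act M x = act N x * (S + T)" for x
      using add_mult_distrib_mat[OF cS cT a(1)] mult_add_distrib_mat[OF a(2) cS cT] eS eT by simp
    then show "S \<oplus>\<^bsub>?V\<^esub> T \<in> Hom_U M N" using cS cT by (simp add: Hom_U_def module_mat_simps)
  qed
  then show ?thesis using v.vectorspace_axioms by (simp add: subspace_def)
qed

lemma dim_Hom_U_le:
  assumes "\<And>g. gmat M g \<in> carrier_mat (udim M) (udim M)" "\<And>g. gmat N g \<in> carrier_mat (udim N) (udim N)"
  shows "dim_Hom_U M N \<le> udim N * udim M"
proof -
  let ?V = "module_mat TYPE(complex) (udim N) (udim M)"
  interpret v: vectorspace "class_ring :: complex ring" ?V by (rule matrix_vs)
  show ?thesis unfolding dim_Hom_U_def
    using v.subspace_fin_dim_dim(2)[OF Hom_U_subspace[of M N, OF assms] matrix_fin_dim(1)] matrix_fin_dim(2)[of "udim N" "udim M"] by linarith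
qed

lemma udim_word: "udim (word_module q w) = 2 ^ length w"
  by (induction w) (simp_all add: word_module_def tensor_module_def eval_module_def trivial_module_def)

lemma hom_dim_le:
  assumes "q \<noteq> 0" "q ^ 2 \<noteq> 1"
  shows "hom_dim q w \<le> 2 ^ length w"
  using dim_Hom_U_le[of trivial_module "word_module q w"] U_module_word[OF assms, of w] U_module_trivial[of q]
  by (simp add: U_module_def udim_word hom_dim_def) (simp add: trivial_module_def)

lemma hom_dim_words:
  assumes "q \<noteq> 0" "q ^ 2 \<noteq> 1"
  shows "finite (hom_dim q ` words k)" "hom_dim q ` words k \<noteq> {}"
proof -
  have "hom_dim q ` words k \<subseteq> {..2 ^ k}" using hom_dim_le[OF assms] by (auto simp: words_def)
  then show "finite (hom_dim q ` words k)" by (rule finite_subset) simp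
  have "replicate k 0 \<in> words k" by (auto simp: words_def)
  then show "hom_dim q ` words k \<noteq> {}" by blast
qed

end

theory Submission
  imports Defs
begin

text \<open>
  Upper bound: already the invariants of the subalgebra generated by $e_1$ and $K$ are few. Splitting off the first
  tensor factor shows that $e_1$ is injective on negative weight spaces, and then that a vector of weight $m$ killed
  by $e_1$ is determined by its coordinates at ballot sequences; for $m = 0$ these are counted by the Catalan numbers.

  Lower bound: inserting the invariant of $a \otimes (a + 2)$ into a word maps invariants injectively to invariants,
  so prepending such a pair gives monotonicity. For the words $(0, -2)^m (0, 2)^p$, the first $0$ after the last $-2$
  can be paired with the $-2$ to its left or the $2$ to its right. Both insertions have images with trivial
  intersection, so the dimensions satisfy Pascal's recurrence from below and are at least $\binom{m+p-1}{m}$.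
\<close>

section \<open>Invariants as functions on sign sequences\<close>

text \<open>Kronecker products number basis vectors by quotients and remainders, which is unwieldy
  when factors are inserted into the middle of a word. The modules are therefore rebuilt as
  functions on lists of signs: each generator acts by recursion on the word, opening one tensor
  factor at a time, and matrices return only when dimensions are compared.

  For the upper bound, injectivity of \<open>e_1\<close> on negative weights does not pass through
  an induction as it stands. If \<open>(x, y)\<close> of weight -1 is killed by \<open>e_1\<close>,
  then \<open>y\<close> has weight 0 and need not vanish; one only learns that \<open>e_1^2\<close>
  kills \<open>x\<close>, which has weight -2. The statement that survives is that
  \<open>e_1^j\<close> is injective on weight \<open>-j\<close>, and its proof needs nonzero
  q-integers.

  For the lower bound, the two insertions need parameters \<open>a\<close>, \<open>a + 2\<close>,
  \<open>a + 4\<close> in a row. The zigzag words have such a place, -2, 0, 2, where their two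
  halves meet. Deleting either pair leaves a zigzag word again, which closes the recurrence.\<close>

lemma (in linear_map) inj_imp_dim_le:
  assumes "V.fin_dim" "W.fin_dim" "inj_on T (carrier V)"
  shows "V.dim \<le> W.dim"
proof -
  have "vectorspace.dim K (W.vs imT) + vectorspace.dim K (V.vs kerT) = V.dim"
    by (rule rank_nullity[OF assms(1)])
  moreover have "vectorspace.dim K (V.vs kerT) = 0"
    by (rule inj_imp_dim_ker0[OF assms(3)])
  moreover have "vectorspace.dim K (W.vs imT) \<le> W.dim"
    by (rule W.subspace_fin_dim_dim(2)[OF imT_is_subspace assms(2)])
  ultimately show ?thesis by simp
qed

text \<open>Reads the list as a binary number with the first sign as leading digit, which is the
  numbering of tensor basis vectors fixed by \<open>kron\<close>.\<close>

primrec list_index :: "bool list \<Rightarrow> nat" where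
  "list_index [] = 0"
| "list_index (b # s) = (if b then 2 ^ length s else 0) + list_index s"

lemma list_index_less: "list_index s < 2 ^ length s"
  by (induction s) auto

lemma bij_betw_list_index: "bij_betw list_index {s. length s = k} {..<2 ^ k}"
proof -
  have "inj_on list_index {s. length s = k}"
  proof (induction k)
    case (Suc k)
    have "s = t" if len: "length s = Suc k" "length t = Suc k" and eq: "list_index s = list_index t" for s t
    proof -
      obtain b s' c t' where st: "s = b # s'" "t = c # t'" and l: "length s' = k" "length t' = k"
        using len by (metis length_Suc_conv)
      have less: "list_index s' < 2 ^ k" "list_index t' < 2 ^ k" using list_index_less[of s'] list_index_less[of t'] l by auto
      have "b = c" using eq less by (auto simp: st l split: if_splits)
      moreover have "list_index s' = list_index t'" using eq less \<open>b = c\<close> by (auto simp: st l)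
      ultimately show ?thesis using Suc l by (auto simp: st inj_on_def)
    qed
    then show ?case by (auto simp: inj_on_def)
  qed (auto simp: inj_on_def)
  moreover have "card {s :: bool list. length s = k} = 2 ^ k"
    using card_lists_length_eq[of "UNIV :: bool set" k] by simp
  moreover have "list_index ` {s. length s = k} \<subseteq> {..<2 ^ k}"
    using list_index_less by auto
  ultimately show ?thesis
    unfolding bij_betw_def using card_subset_eq[of "{..<2 ^ k}" "list_index ` {s. length s = k}"]
    by (simp add: card_image)
qed

text \<open>In a list indexing a basis vector, \<open>False\<close> stands for $v_+$ and \<open>True\<close> for $v_-$. Below, \<open>x\<close> and \<open>y\<close> are the
  components of \<open>f\<close> along $v_+$ and $v_-$ in the first tensor factor.\<close>

primrec word_op :: "complex \<Rightarrow> int list \<Rightarrow> ugen \<Rightarrow> (bool list \<Rightarrow> complex) \<Rightarrow> bool list \<Rightarrow> complex" where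
  "word_op q [] = (\<lambda>g f s. if g \<in> {Kp, Km} then f s else 0)"
| "word_op q (a # w) = (\<lambda>g f s. case s of [] \<Rightarrow> 0 | b # t \<Rightarrow>
     (let x = (\<lambda>t. f (False # t)); y = (\<lambda>t. f (True # t)) in
      case g of
        Kp \<Rightarrow> if b then 1 / q * word_op q w Kp y t else q * word_op q w Kp x t
      | Km \<Rightarrow> if b then q * word_op q w Km y t else 1 / q * word_op q w Km x t
      | E1 \<Rightarrow> if b then word_op q w E1 y t else word_op q w Kp y t + word_op q w E1 x t
      | E0 \<Rightarrow> if b then q powi a * word_op q w Km x t + word_op q w E0 y t else word_op q w E0 x t
      | F1 \<Rightarrow> if b then x t + q * word_op q w F1 y t else 1 / q * word_op q w F1 x t
      | F0 \<Rightarrow> if b then 1 / q * word_op q w F0 y t else q powi (- a) * y t + q * word_op q w F0 x t))"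

text \<open>The value 0 on lists of the wrong length lets the vanishing of a vector be stated as an
  equation between functions.\<close>

definition coords :: "nat \<Rightarrow> complex mat \<Rightarrow> bool list \<Rightarrow> complex" where
  "coords k T s = (if length s = k then T $$ (list_index s, 0) else 0)"

text \<open>The column is cut into two blocks of height \<open>n\<close>, its components along
  \<open>v_+\<close> and \<open>v_-\<close> of the first factor. \<open>A\<close> mixes the blocks
  and \<open>B\<close> acts inside each of them.\<close>

lemma kron_mult_col:
  assumes A: "A \<in> carrier_mat 2 2" and B: "B \<in> carrier_mat n n" and T: "T \<in> carrier_mat (2 * n) 1"
    and r: "r < n" and i: "i < 2"
  shows "(kron A B * T) $$ (i * n + r, 0) =
    A $$ (i, 0) * (B * mat n 1 (\<lambda>(j, _). T $$ (j, 0))) $$ (r, 0) +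
    A $$ (i, 1) * (B * mat n 1 (\<lambda>(j, _). T $$ (n + j, 0))) $$ (r, 0)"
proof -
  have n: "n > 0" using r by simp
  have ir: "i * n + r < 2 * n"
    using i r by (cases i) auto
  have "(kron A B * T) $$ (i * n + r, 0) = (\<Sum>k<2 * n. (A $$ (i, k div n) * B $$ (r, k mod n)) * T $$ (k, 0))"
    using A B T ir r by (auto simp: kron_def scalar_prod_def lessThan_atLeast0 intro!: sum.cong)
  also have "\<dots> = (\<Sum>k<2 * n. A $$ (i, k div n) * B $$ (r, k mod n) * T $$ (k div n * n + k mod n, 0))"
    by simp
  also have "\<dots> = (\<Sum>k<2. \<Sum>l<n. A $$ (i, k) * B $$ (r, l) * T $$ (k * n + l, 0))"
    by (rule sum_div_mod[OF n])
  also have "\<dots> = A $$ (i, 0) * (\<Sum>l<n. B $$ (r, l) * T $$ (l, 0)) + A $$ (i, 1) * (\<Sum>l<n. B $$ (r, l) * T $$ (n + l, 0))"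
    by (simp add: numeral_2_eq_2 sum_distrib_left mult.assoc)
  also have "(\<Sum>l<n. B $$ (r, l) * T $$ (l, 0)) = (B * mat n 1 (\<lambda>(j, _). T $$ (j, 0))) $$ (r, 0)"
    using B r by (auto simp: scalar_prod_def lessThan_atLeast0)
  also have "(\<Sum>l<n. B $$ (r, l) * T $$ (n + l, 0)) = (B * mat n 1 (\<lambda>(j, _). T $$ (n + j, 0))) $$ (r, 0)"
    using B r by (auto simp: scalar_prod_def lessThan_atLeast0)
  finally show ?thesis .
qed

lemma word_gmat_carrier: "gmat (word_module q w) g \<in> carrier_mat (2 ^ length w) (2 ^ length w)"
proof (induction w arbitrary: g)
  case Nil
  then show ?case by (auto simp: word_module_def trivial_module_def)
next
  case (Cons a w)
  have "gmat (eval_module q a) g \<in> carrier_mat 2 2" for g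
    by (cases g) (auto simp: eval_module_def mat2_carrier)
  moreover have "kron A B \<in> carrier_mat (2 * 2 ^ length w) (2 * 2 ^ length w)"
    if "A \<in> carrier_mat 2 2" "B \<in> carrier_mat (2 ^ length w) (2 ^ length w)" for A B
    using kron_carrier[OF that] .
  moreover have "word_module q (a # w) = tensor_module (eval_module q a) (word_module q w)"
    by (simp add: word_module_def)
  moreover have "udim (eval_module q a) = 2" by (simp add: eval_module_def)
  ultimately show ?case using Cons
    by (cases g) (simp_all add: tensor_module_def udim_word)
qed

lemma mat2_index [simp]:
  "mat2 a b c d $$ (0, 0) = a" "mat2 a b c d $$ (0, Suc 0) = b"
  "mat2 a b c d $$ (Suc 0, 0) = c" "mat2 a b c d $$ (Suc 0, Suc 0) = d"
  "dim_row (mat2 a b c d) = 2" "dim_col (mat2 a b c d) = 2"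
  by (auto simp: mat2_def mat_of_rows_list_def)

text \<open>Every summand of the coproduct is one Kronecker product, so opening the first factor
  turns the matrix action into the recursion of \<open>word_op\<close>, with \<open>X\<close> and
  \<open>Y\<close> as the two blocks of the column.\<close>

lemma coords_gmat:
  assumes "T \<in> carrier_mat (2 ^ length w) 1" "length s = length w"
  shows "(gmat (word_module q w) g * T) $$ (list_index s, 0) = word_op q w g (coords (length w) T) s"
  using assms
proof (induction w arbitrary: g T s)
  case Nil
  then show ?case by (auto simp: word_module_def trivial_module_def coords_def scalar_prod_def)
next
  case (Cons a w)
  define n where "n = (2::nat) ^ length w"
  define X where "X = mat n 1 (\<lambda>(j, _). T $$ (j, 0))"
  define Y where "Y = mat n 1 (\<lambda>(j, _). T $$ (n + j, 0))"
  define M where "M = word_module q w"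
  obtain b t where s: "s = b # t" and t: "length t = length w"
    using Cons.prems(2) by (metis length_Suc_conv)
  define r where "r = list_index t"
  have r: "r < n" using list_index_less[of t] t by (simp add: r_def n_def)
  have cT: "T \<in> carrier_mat (2 * n) 1" using Cons.prems(1) by (simp add: n_def)
  have cXY: "X \<in> carrier_mat n 1" "Y \<in> carrier_mat n 1" by (auto simp: X_def Y_def)
  have cM: "gmat M g \<in> carrier_mat n n" for g using word_gmat_carrier by (simp add: M_def n_def)
  have uM: "udim M = n" by (simp add: M_def udim_word n_def)
  have less: "list_index t < n" if "length t = length w" for t
    using list_index_less[of t] that by (simp add: n_def)
  have x: "(\<lambda>t. coords (length (a # w)) T (False # t)) = coords (length w) X"
    using less by (auto simp: coords_def X_def fun_eq_iff)
  have y: "(\<lambda>t. coords (length (a # w)) T (True # t)) = coords (length w) Y"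
    using less by (auto simp: coords_def Y_def fun_eq_iff n_def)
  have IH: "word_op q w g (coords (length w) Z) t = (gmat M g * Z) $$ (r, 0)" if "Z \<in> carrier_mat n 1" for g Z
    using Cons.IH[of Z t g] that t by (simp add: M_def r_def n_def)
  have val: "coords (length w) Z t = Z $$ (r, 0)" for Z by (simp add: coords_def t r_def)
  have li: "list_index s = (if b then 1 else 0) * n + r" by (simp add: s t n_def r_def)
  have W: "word_module q (a # w) = tensor_module (eval_module q a) M"
    by (simp add: word_module_def M_def)
  have kc: "(kron A B * T) $$ ((if b then 1 else 0) * n + r, 0) =
    A $$ (if b then 1 else 0, 0) * (B * X) $$ (r, 0) + A $$ (if b then 1 else 0, 1) * (B * Y) $$ (r, 0)"
    if "A \<in> carrier_mat 2 2" "B \<in> carrier_mat n n" for A B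
    using kron_mult_col[OF that cT r, of "if b then 1 else 0"] by (simp add: X_def Y_def)
  have ka: "((kron A B + kron A' B') * T) $$ ((if b then 1 else 0) * n + r, 0) =
     (kron A B * T) $$ ((if b then 1 else 0) * n + r, 0) + (kron A' B' * T) $$ ((if b then 1 else 0) * n + r, 0)"
    if "A \<in> carrier_mat 2 2" "B \<in> carrier_mat n n" "A' \<in> carrier_mat 2 2" "B' \<in> carrier_mat n n" for A B A' B'
  proof -
    have "(kron A B + kron A' B') * T = kron A B * T + kron A' B' * T"
      by (rule add_mult_distrib_mat[of _ "2*n" "2*n" _ _ 1]) (use that cT in auto)
    then show ?thesis using that r cT by (auto simp: kron_def)
  qed
  have one: "1\<^sub>m n * X = X" "1\<^sub>m n * Y = Y" using cXY by auto
  have smc: "c \<cdot>\<^sub>m mat2 c1 c2 c3 c4 \<in> carrier_mat 2 2" for c c1 c2 c3 c4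
    using mat2_carrier by simp
  note cs = mat2_carrier cM one_carrier_mat smc
  note xy = fun_cong[OF x, simplified] fun_cong[OF y, simplified] val
  note op = word_op.simps(2) list.case Let_def x y IH[OF cXY(1)] IH[OF cXY(2)] val
  note gm = tensor_module_def eval_module_def umod.select_convs tensor_gmat.simps eval_gmat.simps uM
  have "(gmat (tensor_module (eval_module q a) M) g * T) $$ ((if b then 1 else 0) * n + r, 0) =
    word_op q (a # w) g (coords (length (a # w)) T) (b # t)"
  proof (cases g)
    case E0
    show ?thesis unfolding E0 op gm ugen.case ka[OF cs(4,2) cs(3,2)] kc[OF cs(4,2)] kc[OF cs(3,2)]
      by (simp add: one_mat2 smult_mat2)
  next
    case E1
    show ?thesis unfolding E1 op gm ugen.case ka[OF cs(1,2) cs(3,2)] kc[OF cs(1,2)] kc[OF cs(3,2)]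
      by (simp add: one_mat2 smult_mat2)
  next
    case F0
    show ?thesis unfolding F0 op gm ugen.case ka[OF cs(4,3) cs(1,2)] kc[OF cs(1,2)] kc[OF cs(4,3)] one
      by (simp add: one_mat2 smult_mat2 xy)
  next
    case F1
    show ?thesis unfolding F1 op gm ugen.case ka[OF cs(1,3) cs(1,2)] kc[OF cs(1,2)] kc[OF cs(1,3)] one
      by (simp add: one_mat2 smult_mat2 xy)
  next
    case Kp
    show ?thesis unfolding Kp op gm ugen.case kc[OF cs(1,2)]
      by simp
  next
    case Km
    show ?thesis unfolding Km op gm ugen.case kc[OF cs(1,2)]
      by simp
  qed
  then show ?case unfolding s li[unfolded s] W .
qed

text \<open>A homomorphism from the trivial module is given by the image of 1; these functions are
  the coordinates of such images.\<close>

definition invariants :: "complex \<Rightarrow> int list \<Rightarrow> (bool list \<Rightarrow> complex) set" where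
  "invariants q w = {f. (\<forall>s. length s \<noteq> length w \<longrightarrow> f s = 0) \<and>
     (\<forall>g s. length s = length w \<longrightarrow> word_op q w g f s = (if g \<in> {Kp, Km} then f s else 0))}"

text \<open>The intertwining condition passes through scalars, sums and products, so it is enough to
  test it on the six generators.\<close>

lemma Hom_trivial_iff:
  assumes c: "\<And>g. gmat N g \<in> carrier_mat (udim N) (udim N)"
  shows "T \<in> Hom_U trivial_module N \<longleftrightarrow> T \<in> carrier_mat (udim N) 1 \<and>
    (\<forall>g. gmat N g * T = (if g \<in> {Kp, Km} then T else 0\<^sub>m (udim N) 1))"
proof (cases "T \<in> carrier_mat (udim N) 1")
  case T: True
  have u1: "udim trivial_module = 1" by (simp add: trivial_module_def)
  have t: "T * gmat trivial_module g = (if g \<in> {Kp, Km} then T else 0\<^sub>m (udim N) 1)" for g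
    using right_mult_one_mat[OF T] right_mult_zero_mat[OF T] by (simp add: trivial_module_def)
  have a: "act trivial_module z \<in> carrier_mat 1 1" "act N z \<in> carrier_mat (udim N) (udim N)" for z
    using act_carrier[of trivial_module z] by (simp_all add: act_carrier c trivial_module_def)
  have "T * act trivial_module x = act N x * T" if g: "\<And>g. T * gmat trivial_module g = gmat N g * T" for x
  proof (induction x)
    case (Scal z)
    have "T * (z \<cdot>\<^sub>m 1\<^sub>m 1) = z \<cdot>\<^sub>m T"
      using mult_smult_distrib[OF T one_carrier_mat, of z] right_mult_one_mat[OF T] by simp
    moreover have "z \<cdot>\<^sub>m 1\<^sub>m (udim N) * T = z \<cdot>\<^sub>m T"
      using mult_smult_assoc_mat[OF one_carrier_mat T, of z] left_mult_one_mat[OF T] by simp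
    ultimately show ?case by (simp add: u1)
  next
    case (Add x y)
    show ?case
      using mult_add_distrib_mat[OF T a(1) a(1), of x y] add_mult_distrib_mat[OF a(2) a(2) T, of x y] Add by simp
  next
    case (Mul x y)
    have "T * (act trivial_module x * act trivial_module y) = T * act trivial_module x * act trivial_module y"
      by (rule assoc_mult_mat[OF T a(1) a(1), symmetric])
    also have "\<dots> = act N x * (T * act trivial_module y)"
      unfolding Mul(1) by (rule assoc_mult_mat[OF a(2) T a(1)])
    also have "\<dots> = act N x * act N y * T"
      unfolding Mul(2) by (rule assoc_mult_mat[OF a(2) a(2) T, symmetric])
    finally show ?case by simp
  qed (use g in simp)
  moreover have "T * gmat trivial_module g = gmat N g * T" if "\<And>x. T * act trivial_module x = act N x * T" for g
    using that[of "Gen g"] by simp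
  ultimately have "(\<forall>x. T * act trivial_module x = act N x * T) \<longleftrightarrow>
    (\<forall>g. T * gmat trivial_module g = gmat N g * T)"
    by blast
  also have "\<dots> \<longleftrightarrow> (\<forall>g. gmat N g * T = (if g \<in> {Kp, Km} then T else 0\<^sub>m (udim N) 1))"
    unfolding t by (rule iff_allI) (rule eq_commute)
  finally show ?thesis using T unfolding Hom_U_def u1 mem_Collect_eq by simp
qed (auto simp: Hom_U_def trivial_module_def)

lemma mat_col_eqI:
  assumes "A \<in> carrier_mat (2 ^ k) 1" "B \<in> carrier_mat (2 ^ k) 1"
    and "\<And>s. length s = k \<Longrightarrow> A $$ (list_index s, 0) = B $$ (list_index s, 0)"
  shows "A = B"
proof (rule eq_matI)
  fix i j assume "i < dim_row B" "j < dim_col B"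
  then have "i \<in> {..<2 ^ k}" and j: "j = 0" using assms by auto
  then obtain s where "length s = k" "i = list_index s"
    using bij_betw_list_index[of k] unfolding bij_betw_def by blast
  then show "A $$ (i, j) = B $$ (i, j)" using assms(3) j by simp
qed (use assms in auto)

lemma Hom_word_iff:
  assumes T: "T \<in> carrier_mat (2 ^ length w) 1"
  shows "T \<in> Hom_U trivial_module (word_module q w) \<longleftrightarrow> coords (length w) T \<in> invariants q w"
proof -
  let ?M = "word_module q w" and ?k = "length w"
  have cM: "gmat ?M g \<in> carrier_mat (2 ^ ?k) (2 ^ ?k)" for g by (rule word_gmat_carrier)
  have "gmat ?M g * T = (if g \<in> {Kp, Km} then T else 0\<^sub>m (2 ^ ?k) 1) \<longleftrightarrow>
    (\<forall>s. length s = ?k \<longrightarrow> word_op q w g (coords ?k T) s = (if g \<in> {Kp, Km} then coords ?k T s else 0))" for g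
  proof -
    have c: "gmat ?M g * T \<in> carrier_mat (2 ^ ?k) 1"
      "(if g \<in> {Kp, Km} then T else 0\<^sub>m (2 ^ ?k) 1) \<in> carrier_mat (2 ^ ?k) 1"
      using cM[of g] T by auto
    have v: "(if g \<in> {Kp, Km} then T else 0\<^sub>m (2 ^ ?k) 1) $$ (list_index s, 0) =
      (if g \<in> {Kp, Km} then coords ?k T s else 0)" if "length s = ?k" for s
      using that list_index_less[of s] by (auto simp: coords_def)
    have e: "(gmat ?M g * T) $$ (list_index s, 0) = word_op q w g (coords ?k T) s" if "length s = ?k" for s
      by (rule coords_gmat[OF T that])
    show ?thesis
    proof
      assume eq: "gmat ?M g * T = (if g \<in> {Kp, Km} then T else 0\<^sub>m (2 ^ ?k) 1)"
      then show "\<forall>s. length s = ?k \<longrightarrow> word_op q w g (coords ?k T) s = (if g \<in> {Kp, Km} then coords ?k T s else 0)"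
        by (simp only: e[symmetric] v[symmetric] eq cong: imp_cong) simp
    next
      assume r: "\<forall>s. length s = ?k \<longrightarrow> word_op q w g (coords ?k T) s = (if g \<in> {Kp, Km} then coords ?k T s else 0)"
      show "gmat ?M g * T = (if g \<in> {Kp, Km} then T else 0\<^sub>m (2 ^ ?k) 1)"
        by (rule mat_col_eqI[OF c]) (simp only: e r v)
    qed
  qed
  then have "(\<forall>g. gmat ?M g * T = (if g \<in> {Kp, Km} then T else 0\<^sub>m (2 ^ ?k) 1)) \<longleftrightarrow>
    (\<forall>g s. length s = ?k \<longrightarrow> word_op q w g (coords ?k T) s = (if g \<in> {Kp, Km} then coords ?k T s else 0))"
    by blast
  moreover have "coords ?k T s = 0" if "length s \<noteq> ?k" for s using that by (simp add: coords_def)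
  moreover have "T \<in> Hom_U trivial_module ?M \<longleftrightarrow> T \<in> carrier_mat (2 ^ ?k) 1 \<and>
    (\<forall>g. gmat ?M g * T = (if g \<in> {Kp, Km} then T else 0\<^sub>m (2 ^ ?k) 1))"
    using Hom_trivial_iff[of ?M T, unfolded udim_word, OF cM] .
  ultimately show ?thesis
    using T unfolding invariants_def mem_Collect_eq by (simp only: simp_thms) simp
qed

section \<open>Comparing dimensions of spaces of invariants\<close>

lemma Hom_word_vectorspace:
  fixes q w defines "H \<equiv> (module_mat TYPE(complex) (2 ^ length w) 1)\<lparr>carrier := Hom_U trivial_module (word_module q w)\<rparr>"
  shows "vectorspace class_ring H" "vectorspace.fin_dim class_ring H" "vectorspace.dim class_ring H = hom_dim q w"
proof -
  let ?V = "module_mat TYPE(complex) (2 ^ length w) 1"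
  interpret v: vectorspace "class_ring :: complex ring" ?V by (rule matrix_vs)
  have u1: "udim trivial_module = 1" by (simp add: trivial_module_def)
  have sub: "subspace class_ring (Hom_U trivial_module (word_module q w)) ?V"
    by (rule Hom_U_subspace[of trivial_module "word_module q w", unfolded udim_word u1, OF _ word_gmat_carrier])
      (simp add: trivial_module_def)
  show "vectorspace class_ring H" unfolding H_def by (rule v.subspace_is_vs[OF sub])
  show "vectorspace.fin_dim class_ring H" unfolding H_def
    by (rule v.subspace_fin_dim_dim(1)[OF sub matrix_fin_dim(1)])
  show "vectorspace.dim class_ring H = hom_dim q w"
    by (simp add: hom_dim_def dim_Hom_U_def H_def udim_word u1)
qed

lemma linear_map_dim_le:
  assumes V: "vectorspace K V" "vectorspace.fin_dim K V" and W: "vectorspace K W" "vectorspace.fin_dim K W"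
    and T: "T \<in> LinearCombinations.module_hom K V W" and inj: "\<And>v. v \<in> carrier V \<Longrightarrow> T v = \<zero>\<^bsub>W\<^esub> \<Longrightarrow> v = \<zero>\<^bsub>V\<^esub>"
  shows "vectorspace.dim K V \<le> vectorspace.dim K W"
proof -
  interpret linear_map K V W T
    using V(1) W(1) T by (simp add: linear_map_def mod_hom_def mod_hom_axioms_def vectorspace_def)
  have "inj_on T (carrier V)"
    by (rule Ke0_imp_inj) (use inj in \<open>auto simp: mod_hom.ker_def\<close>)
  then show ?thesis by (rule inj_imp_dim_le[OF V(2) W(2)])
qed

text \<open>Linearity in one statement: scalar multiples, sums of two functions and the zero
  function are the index sets \<open>{()}\<close>, \<open>UNIV :: bool set\<close> and
  \<open>{}\<close>.\<close>

lemma word_op_sum: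
  "word_op q w g (\<lambda>s. \<Sum>i\<in>I. c i * f i s) s = (\<Sum>i\<in>I. c i * word_op q w g (f i) s)"
proof (induction w arbitrary: g f s)
  case (Cons a w)
  show ?case
    by (cases s; cases g) (simp_all add: Let_def Cons.IH sum.distrib sum_distrib_left algebra_simps)
qed simp

lemma invariants_sum:
  assumes "\<And>i. i \<in> I \<Longrightarrow> g i \<in> invariants q w"
  shows "(\<lambda>s. \<Sum>i\<in>I. c i * g i s) \<in> invariants q w"
proof -
  have "g i s = 0" if "i \<in> I" "length s \<noteq> length w" for i s
    using assms[OF that(1)] that by (simp add: invariants_def)
  moreover have "word_op q w h (g i) s = (if h \<in> {Kp, Km} then g i s else 0)" if "i \<in> I" "length s = length w" for h i s
    using assms[OF that(1)] that by (simp add: invariants_def)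
  ultimately show ?thesis
    by (simp add: invariants_def word_op_sum cong: sum.cong)
qed

definition of_coords :: "nat \<Rightarrow> (bool list \<Rightarrow> complex) \<Rightarrow> complex mat" where
  "of_coords k f = mat (2 ^ k) 1 (\<lambda>(j, _). f (inv_into {s. length s = k} list_index j))"

lemma of_coords_carrier [simp]: "of_coords k f \<in> carrier_mat (2 ^ k) 1"
  by (simp add: of_coords_def)

lemma of_coords_add: "of_coords k (\<lambda>s. f s + g s) = of_coords k f + of_coords k g"
  by (rule eq_matI) (simp_all add: of_coords_def)

lemma of_coords_smult: "of_coords k (\<lambda>s. c * f s) = c \<cdot>\<^sub>m of_coords k f"
  by (rule eq_matI) (simp_all add: of_coords_def)

lemma coords_of_coords:
  assumes "\<And>s. length s \<noteq> k \<Longrightarrow> f s = 0"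
  shows "coords k (of_coords k f) = f"
proof
  fix s show "coords k (of_coords k f) s = f s"
  proof (cases "length s = k")
    case True
    have "inv_into {s. length s = k} list_index (list_index s) = s"
      by (rule inv_into_f_f[OF bij_betw_imp_inj_on[OF bij_betw_list_index]]) (simp add: True)
    then show ?thesis using True list_index_less[of s] by (simp add: coords_def of_coords_def)
  next
    case False
    then show ?thesis using assms by (simp add: coords_def)
  qed
qed

lemma coords_add:
  assumes "M \<in> carrier_mat (2 ^ k) 1" "N \<in> carrier_mat (2 ^ k) 1"
  shows "coords k (M + N) s = coords k M s + coords k N s"
  using assms list_index_less[of s] by (auto simp: coords_def)

lemma coords_smult:
  assumes "M \<in> carrier_mat (2 ^ k) 1"
  shows "coords k (c \<cdot>\<^sub>m M) s = c * coords k M s"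
  using assms list_index_less[of s] by (auto simp: coords_def)

lemma coords_zero [simp]: "coords k (0\<^sub>m (2 ^ k) 1) s = 0"
  using list_index_less[of s] by (cases "length s = k") (simp_all add: coords_def)

lemma coords_eq_0D:
  assumes M: "M \<in> carrier_mat (2 ^ k) 1" and z: "\<And>s. coords k M s = 0"
  shows "M = 0\<^sub>m (2 ^ k) 1"
proof (rule mat_col_eqI[OF M])
  fix s :: "bool list" assume l: "length s = k"
  have "0\<^sub>m (2 ^ k) 1 $$ (list_index s, 0) = (0 :: complex)"
    using list_index_less[of s] l by simp
  moreover have "M $$ (list_index s, 0) = 0"
    using z[of s] l by (simp add: coords_def)
  ultimately show "M $$ (list_index s, 0) = 0\<^sub>m (2 ^ k) 1 $$ (list_index s, 0)" by simp
qed simp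

lemma invariants_supported: "f \<in> invariants q w \<Longrightarrow> length s \<noteq> length w \<Longrightarrow> f s = 0"
  by (simp add: invariants_def)

lemma Hom_word_coords:
  assumes "M \<in> Hom_U trivial_module (word_module q w)"
  shows "M \<in> carrier_mat (2 ^ length w) 1" "coords (length w) M \<in> invariants q w"
proof -
  show c: "M \<in> carrier_mat (2 ^ length w) 1"
    using assms by (simp add: Hom_U_def udim_word trivial_module_def)
  show "coords (length w) M \<in> invariants q w"
    using Hom_word_iff[OF c] assms by blast
qed

lemma of_coords_Hom:
  assumes "f \<in> invariants q w"
  shows "of_coords (length w) f \<in> Hom_U trivial_module (word_module q w)"
  using Hom_word_iff[OF of_coords_carrier, of w f q] coords_of_coords[of "length w" f] assms invariants_supported
  by simp

text \<open>An independent family of invariants is an injective linear map out of the space of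
  vectors of length \<open>n\<close>, so lower bounds only require exhibiting vectors.\<close>

lemma hom_dim_ge:
  assumes g: "\<And>i. i < n \<Longrightarrow> g i \<in> invariants q w"
    and lin: "\<And>c :: nat \<Rightarrow> complex. (\<And>s. (\<Sum>i<n. c i * g i s) = 0) \<Longrightarrow> (\<forall>i<n. c i = 0)"
  shows "n \<le> hom_dim q w"
proof -
  define H where "H = (module_mat TYPE(complex) (2 ^ length w) 1)\<lparr>carrier := Hom_U trivial_module (word_module q w)\<rparr>"
  note H = Hom_word_vectorspace[of q w, folded H_def]
  define G where "G v = (\<lambda>s. \<Sum>i<n. v $ i * g i s)" for v :: "complex vec"
  define T where "T v = of_coords (length w) (G v)" for v
  have G: "G v \<in> invariants q w" for v
    unfolding G_def by (rule invariants_sum) (simp add: g)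
  have H_simps: "add H = (+)" "smult H = (\<cdot>\<^sub>m)" "zero H = 0\<^sub>m (2 ^ length w) 1"
    "carrier H = Hom_U trivial_module (word_module q w)"
    by (simp_all add: H_def module_mat_simps)
  have "vectorspace.dim class_ring (module_vec TYPE(complex) n) \<le> vectorspace.dim class_ring H"
  proof (rule linear_map_dim_le[OF vec_vs vec_space.fin_dim H(1,2), of T])
    have "T (u + v) = T u + T v" if "u \<in> carrier_vec n" "v \<in> carrier_vec n" for u v
    proof -
      have "G (u + v) = (\<lambda>s. G u s + G v s)"
        using that by (simp add: G_def distrib_right sum.distrib)
      then show ?thesis by (simp add: T_def of_coords_add)
    qed
    moreover have "T (c \<cdot>\<^sub>v v) = c \<cdot>\<^sub>m T v" if "v \<in> carrier_vec n" for c v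
    proof -
      have "G (c \<cdot>\<^sub>v v) = (\<lambda>s. c * G v s)"
        using that by (simp add: G_def sum_distrib_left mult.assoc)
      then show ?thesis by (simp add: T_def of_coords_smult)
    qed
    moreover have "T v \<in> Hom_U trivial_module (word_module q w)" for v
      unfolding T_def by (rule of_coords_Hom[OF G])
    ultimately show "T \<in> LinearCombinations.module_hom class_ring (module_vec TYPE(complex) n) H"
      by (simp add: LinearCombinations.module_hom_def module_vec_simps H_simps)
    fix v assume v: "v \<in> carrier (module_vec TYPE(complex) n)" and "T v = \<zero>\<^bsub>H\<^esub>"
    then have Tv: "T v = 0\<^sub>m (2 ^ length w) 1" by (simp add: H_simps)
    have "G v = coords (length w) (T v)"
      unfolding T_def by (rule coords_of_coords[symmetric]) (rule invariants_supported[OF G])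
    then have "G v s = 0" for s unfolding Tv by (simp only: coords_zero)
    then have "(\<Sum>i<n. v $ i * g i s) = 0" for s by (simp add: G_def)
    then have z: "\<forall>i<n. v $ i = 0" by (rule lin)
    have "v \<in> carrier_vec n" using v by (simp add: module_vec_simps)
    then have "v = 0\<^sub>v n" using z by (intro eq_vecI) auto
    then show "v = \<zero>\<^bsub>module_vec TYPE(complex) n\<^esub>" by (simp add: module_vec_simps)
  qed
  then show ?thesis unfolding vec_space.dim_is_n H(3) .
qed

text \<open>Evaluation at the points of \<open>S\<close> is an injective linear map into the space
  of vectors of length \<open>card S\<close>.\<close>

lemma hom_dim_le_card:
  assumes S: "finite S"
    and det: "\<And>f. f \<in> invariants q w \<Longrightarrow> (\<forall>s\<in>S. f s = 0) \<Longrightarrow> f = (\<lambda>_. 0)"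
  shows "hom_dim q w \<le> card S"
proof -
  define H where "H = (module_mat TYPE(complex) (2 ^ length w) 1)\<lparr>carrier := Hom_U trivial_module (word_module q w)\<rparr>"
  note H = Hom_word_vectorspace[of q w, folded H_def]
  obtain e where e: "bij_betw e {..<card S} S" using ex_bij_betw_nat_finite[OF S] by (auto simp: lessThan_atLeast0)
  define T where "T M = vec (card S) (\<lambda>i. coords (length w) M (e i))" for M
  have H_simps: "add H = (+)" "smult H = (\<cdot>\<^sub>m)" "zero H = 0\<^sub>m (2 ^ length w) 1"
    "carrier H = Hom_U trivial_module (word_module q w)"
    by (simp_all add: H_def module_mat_simps)
  have "vectorspace.dim class_ring H \<le> vectorspace.dim class_ring (module_vec TYPE(complex) (card S))"
  proof (rule linear_map_dim_le[OF H(1,2) vec_vs vec_space.fin_dim, of T])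
    have "T (M + N) = T M + T N" if "M \<in> carrier H" "N \<in> carrier H" for M N
      using that Hom_word_coords(1) by (intro eq_vecI) (simp_all add: T_def H_simps coords_add)
    moreover have "T (c \<cdot>\<^sub>m M) = c \<cdot>\<^sub>v T M" if "M \<in> carrier H" for c M
      using that Hom_word_coords(1) by (intro eq_vecI) (simp_all add: T_def H_simps coords_smult)
    moreover have "T M \<in> carrier_vec (card S)" for M by (simp add: T_def)
    ultimately show "T \<in> LinearCombinations.module_hom class_ring H (module_vec TYPE(complex) (card S))"
      by (simp add: LinearCombinations.module_hom_def module_vec_simps H_simps)
    fix M assume M: "M \<in> carrier H" and "T M = \<zero>\<^bsub>module_vec TYPE(complex) (card S)\<^esub>"
    then have 0: "T M = 0\<^sub>v (card S)" by (simp add: module_vec_simps)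
    have zS: "coords (length w) M s = 0" if s: "s \<in> S" for s
    proof -
      obtain i where "i < card S" "s = e i" using e s unfolding bij_betw_def by blast
      then show ?thesis using arg_cong[OF 0, of "\<lambda>v. v $ i"] by (simp add: T_def)
    qed
    note M' = Hom_word_coords[OF M[unfolded H_simps]]
    have "coords (length w) M = (\<lambda>_. 0)" by (rule det[OF M'(2)]) (simp add: zS)
    then show "M = \<zero>\<^bsub>H\<^esub>" unfolding H_simps by (intro coords_eq_0D[OF M'(1)]) simp
  qed
  then show ?thesis unfolding vec_space.dim_is_n H(3) .
qed

text \<open>Serves monotonicity, where the word attaining the maximum is unknown and no explicit
  family of invariants is at hand.\<close>

lemma hom_dim_mono_linear:
  assumes P: "\<And>f. f \<in> invariants q w \<Longrightarrow> P f \<in> invariants q w'"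
    and add: "\<And>f g. P (\<lambda>s. f s + g s) = (\<lambda>s. P f s + P g s)" and smult: "\<And>c f. P (\<lambda>s. c * f s) = (\<lambda>s. c * P f s)"
    and inj: "\<And>f. f \<in> invariants q w \<Longrightarrow> P f = (\<lambda>_. 0) \<Longrightarrow> f = (\<lambda>_. 0)"
  shows "hom_dim q w \<le> hom_dim q w'"
proof -
  define H where "H w = (module_mat TYPE(complex) (2 ^ length w) 1)\<lparr>carrier := Hom_U trivial_module (word_module q w)\<rparr>" for w
  note H = Hom_word_vectorspace[where q = q, folded H_def]
  define T where "T M = of_coords (length w') (P (coords (length w) M))" for M
  have H_simps: "add (H w) = (+)" "smult (H w) = (\<cdot>\<^sub>m)" "zero (H w) = 0\<^sub>m (2 ^ length w) 1"
    "carrier (H w) = Hom_U trivial_module (word_module q w)" for w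
    by (simp_all add: H_def module_mat_simps)
  have "vectorspace.dim class_ring (H w) \<le> vectorspace.dim class_ring (H w')"
  proof (rule linear_map_dim_le[OF H(1,2) H(1,2), of T])
    have "T (M + N) = T M + T N" if "M \<in> carrier (H w)" "N \<in> carrier (H w)" for M N
    proof -
      have "coords (length w) (M + N) = (\<lambda>s. coords (length w) M s + coords (length w) N s)"
        using that Hom_word_coords(1) by (simp add: fun_eq_iff H_simps coords_add)
      then show ?thesis by (simp only: T_def add of_coords_add)
    qed
    moreover have "T (c \<cdot>\<^sub>m M) = c \<cdot>\<^sub>m T M" if "M \<in> carrier (H w)" for c M
    proof -
      have "coords (length w) (c \<cdot>\<^sub>m M) = (\<lambda>s. c * coords (length w) M s)"
        using that Hom_word_coords(1) by (simp add: fun_eq_iff H_simps coords_smult)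
      then show ?thesis by (simp only: T_def smult of_coords_smult)
    qed
    moreover have "T M \<in> carrier (H w')" if "M \<in> carrier (H w)" for M
      using that unfolding T_def H_simps by (intro of_coords_Hom P Hom_word_coords(2))
    ultimately show "T \<in> LinearCombinations.module_hom class_ring (H w) (H w')"
      by (simp add: LinearCombinations.module_hom_def H_simps)
    fix M assume M: "M \<in> carrier (H w)" and "T M = \<zero>\<^bsub>H w'\<^esub>"
    then have T: "T M = 0\<^sub>m (2 ^ length w') 1" unfolding H_simps by simp
    note M' = Hom_word_coords[OF M[unfolded H_simps]]
    have "P (coords (length w) M) = coords (length w') (T M)"
      unfolding T_def by (rule coords_of_coords[symmetric]) (rule invariants_supported[OF P[OF M'(2)]])
    then have "P (coords (length w) M) = (\<lambda>_. 0)" unfolding T coords_zero[abs_def] .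
    then have "coords (length w) M = (\<lambda>_. 0)" by (rule inj[OF M'(2)])
    then show "M = \<zero>\<^bsub>H w\<^esub>" unfolding H_simps by (intro coords_eq_0D[OF M'(1)]) simp
  qed
  then show ?thesis unfolding H(3) .
qed

section \<open>Cups\<close>

text \<open>Inserts the invariant $q\, v_+ \otimes v_- - v_- \otimes v_+$ of $a \otimes (a + 2)$ after the first \<open>p\<close> factors.\<close>

fun insert_cup :: "complex \<Rightarrow> nat \<Rightarrow> (bool list \<Rightarrow> complex) \<Rightarrow> bool list \<Rightarrow> complex" where
  "insert_cup q 0 f (b # c # t) = (if b = c then 0 else if b then - f t else q * f t)"
| "insert_cup q (Suc p) f (b # t) = insert_cup q p (\<lambda>t. f (b # t)) t"
| "insert_cup q _ f _ = 0"

lemma insert_cup_0: "insert_cup q 0 f s =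
  (case s of b # c # t \<Rightarrow> if b = c then 0 else if b then - f t else q * f t | _ \<Rightarrow> 0)"
  by (auto split: list.split)

lemma insert_cup_Suc: "insert_cup q (Suc p) f s =
  (case s of [] \<Rightarrow> 0 | b # t \<Rightarrow> insert_cup q p (\<lambda>t. f (b # t)) t)"
  by (auto split: list.split)

lemma insert_cup_sum:
  "insert_cup q p (\<lambda>s. \<Sum>i\<in>I. c i * f i s) = (\<lambda>s. \<Sum>i\<in>I. c i * insert_cup q p (f i) s)"
proof
  show "insert_cup q p (\<lambda>s. \<Sum>i\<in>I. c i * f i s) s = (\<Sum>i\<in>I. c i * insert_cup q p (f i) s)" for s
  proof (induction p arbitrary: f s)
    case 0
    show ?case by (simp add: insert_cup_0 sum_distrib_left sum_negf mult.left_commute split: list.split)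
  next
    case (Suc p)
    show ?case by (simp add: insert_cup_Suc Suc.IH split: list.split)
  qed
qed

lemma insert_cup_add: "insert_cup q p (\<lambda>s. f s + g s) = (\<lambda>s. insert_cup q p f s + insert_cup q p g s)"
  using insert_cup_sum[of q p "\<lambda>_. 1" "\<lambda>b. if b then f else g" UNIV] by (simp add: UNIV_bool add.commute)

lemma insert_cup_smult: "insert_cup q p (\<lambda>s. c * f s) = (\<lambda>s. c * insert_cup q p f s)"
  using insert_cup_sum[of q p "\<lambda>_. c" "\<lambda>_. f" "{()}"] by simp

lemma insert_cup_divide: "insert_cup q p (\<lambda>s. f s / c) = (\<lambda>s. insert_cup q p f s / c)"
  using insert_cup_smult[of q p "inverse c" f] by (simp add: divide_inverse mult.commute)

lemma insert_cup_append: "insert_cup q (length u + p) f (u @ t) = insert_cup q p (\<lambda>t. f (u @ t)) t"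
  by (induction u arbitrary: f) simp_all

lemma word_op_smult: "word_op q w g (\<lambda>s. c * f s) s = c * word_op q w g f s"
  using word_op_sum[where I = "{()}" and c = "\<lambda>_. c" and f = "\<lambda>_. f"] by simp

lemma word_op_minus: "word_op q w g (\<lambda>s. - f s) s = - word_op q w g f s"
  using word_op_smult[of q w g "-1"] by simp

lemma word_op_zero: "word_op q w g (\<lambda>s. 0) s = 0"
  using word_op_sum[where I = "{}"] by simp

text \<open>On the cup alone the two terms of \<open>e_1\<close> and of \<open>f_1\<close> cancel
  for any parameters. For \<open>e_0\<close> and \<open>f_0\<close> the factors \<open>K\<close> and
  its inverse leave a discrepancy of \<open>q^2\<close>, which is made up by the second parameter
  exceeding the first by 2. Factors to the left do no harm, because the coproduct only lets
  generators act on what stands to their right.\<close>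

lemma word_op_insert_cup:
  assumes q: "q \<noteq> 0"
  shows "word_op q (u @ a # (a + 2) # r) g (insert_cup q (length u) f) s =
    insert_cup q (length u) (word_op q (u @ r) g f) s"
proof (induction u arbitrary: g f s)
  case Nil
  have p: "q powi (a + 2) = q powi a * q^2" "q powi (- a - 2) * q^2 = q powi (- a)"
    using q by (simp_all add: power_int_add power_int_diff)
  show ?case
  proof (cases "(q, 0::nat, f, s)" rule: insert_cup.cases)
    case (1 q' f' b c t)
    show ?thesis using 1 q p
      by (cases b; cases c; cases g) (auto simp: Let_def word_op_zero word_op_smult word_op_minus field_simps power2_eq_square)
  qed (cases g; auto simp: Let_def)+
next
  case (Cons a' u)
  show ?case
    by (cases s; cases g) (simp_all add: Let_def Cons.IH insert_cup_add insert_cup_smult insert_cup_divide)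
qed

lemma word_op_supported:
  assumes "\<And>s. length s \<noteq> length w \<Longrightarrow> f s = 0" "length s \<noteq> length w"
  shows "word_op q w g f s = 0"
  using assms
proof (induction w arbitrary: g f s)
  case (Cons a w)
  show ?case
  proof (cases s)
    case (Cons b t)
    have "word_op q w h (\<lambda>t. f (c # t)) t = 0" "f (c # t) = 0" for h c
      using Cons.prems \<open>s = b # t\<close> by (auto intro!: Cons.IH)
    then show ?thesis using Cons by (cases g) (simp_all add: Let_def)
  qed simp
qed simp

lemma insert_cup_supported:
  assumes "\<And>s. length s \<noteq> k \<Longrightarrow> f s = 0" "p \<le> k" "length s \<noteq> k + 2"
  shows "insert_cup q p f s = 0"
  using assms
proof (induction p arbitrary: f k s)
  case 0
  then show ?case by (auto simp: insert_cup_0 split: list.split)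
next
  case (Suc p)
  obtain l where k: "k = Suc l" using Suc.prems(2) by (cases k) auto
  show ?case
  proof (cases s)
    case (Cons b t)
    have "insert_cup q p (\<lambda>t. f (b # t)) t = 0"
      by (rule Suc.IH[of l]) (use Suc.prems k Cons in auto)
    then show ?thesis by (simp add: Cons)
  qed simp
qed

lemma insert_cup_invariants:
  assumes q: "q \<noteq> 0" and f: "f \<in> invariants q (u @ r)"
  shows "insert_cup q (length u) f \<in> invariants q (u @ a # (a + 2) # r)"
proof -
  have op: "word_op q (u @ r) g f s = (if g \<in> {Kp, Km} then f s else 0)" if "length s = length (u @ r)" for g s
    using f that by (simp add: invariants_def)
  have outside: "word_op q (u @ r) g f s = 0" if "length s \<noteq> length (u @ r)" for g s
    by (rule word_op_supported[OF _ that]) (rule invariants_supported[OF f])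
  \<comment> \<open>Invariance speaks of lists of the right length only. The support condition
    extends it to all lists, so that it becomes an equation between functions and can be rewritten
    under \<open>insert_cup\<close>.\<close>
  have "word_op q (u @ r) g f = (\<lambda>s. if g \<in> {Kp, Km} then f s else 0)" for g
    using op outside invariants_supported[OF f] by (fastforce simp: fun_eq_iff)
  then have "word_op q (u @ a # (a + 2) # r) g (insert_cup q (length u) f) s =
      insert_cup q (length u) (\<lambda>s. if g \<in> {Kp, Km} then f s else 0) s" for g s
    unfolding word_op_insert_cup[OF q] by simp
  moreover have "insert_cup q (length u) (\<lambda>s. 0) s = 0" for s
    using insert_cup_smult[of q "length u" 0] by (simp add: fun_eq_iff)
  moreover have "insert_cup q (length u) f s = 0" if "length s \<noteq> length u + length r + 2" for s
    by (rule insert_cup_supported[of "length (u @ r)"]) (use that invariants_supported[OF f] in auto)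
  ultimately show ?thesis by (simp add: invariants_def)
qed

text \<open>A cup vanishes on equal signs. To isolate \<open>f\<close> at \<open>u @ b # t\<close>,
  evaluate the sum at the list with signs not-\<open>b\<close>, \<open>b\<close>, \<open>b\<close>
  between \<open>u\<close> and \<open>t\<close>: the second cup sees \<open>b\<close>,
  \<open>b\<close> and drops out, while the first one returns \<open>f\<close> at the given list
  times \<open>q\<close> or -1.\<close>

lemma insert_cup_neighbours:
  assumes q: "q \<noteq> 0" and k: "p < k" and supp: "\<And>s. length s \<noteq> k \<Longrightarrow> f s = 0"
    and eq: "\<And>s. insert_cup q p f s + insert_cup q (Suc p) g s = 0"
  shows "f s = 0"
proof (cases "length s = k")
  case True
  define u where "u = take p s"
  obtain b t where s: "s = u @ b # t" and u: "length u = p"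
    using True k id_take_nth_drop[of p s] by (auto simp: u_def)
  have p: "insert_cup q p f (u @ c) = insert_cup q 0 (\<lambda>t. f (u @ t)) c"
    and Sp: "insert_cup q (Suc p) g (u @ c) = insert_cup q 1 (\<lambda>t. g (u @ t)) c" for c
    using insert_cup_append[of q u 0 f c] insert_cup_append[of q u 1 g c] u by simp_all
  show ?thesis
  proof (cases b)
    case True
    then show ?thesis using eq[of "u @ [False, True] @ b # t"] q by (simp add: p Sp s)
  next
    case False
    then show ?thesis using eq[of "u @ [True, False] @ b # t"] by (simp add: p Sp s)
  qed
qed (simp add: supp)

lemma insert_cup_inj:
  assumes q: "q \<noteq> 0" and k: "p \<le> k" and supp: "\<And>s. length s \<noteq> k \<Longrightarrow> f s = 0"
    and eq: "\<And>s. insert_cup q p f s = 0"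
  shows "f s = 0"
proof (cases "length s = k")
  case True
  have "insert_cup q p f (take p s @ [False, True] @ drop p s) = q * f s"
    using insert_cup_append[of q "take p s" 0 f] True k by simp
  then show ?thesis using q eq by simp
qed (simp add: supp)

section \<open>Independent invariants of zigzag words\<close>

definition zigzag :: "nat \<Rightarrow> nat \<Rightarrow> int list" where
  "zigzag m p = concat (replicate m [0, -2]) @ concat (replicate p [0, 2])"

text \<open>The vectors themselves are carried through the recurrence: adding two bounds on
  \<open>hom_dim\<close> means concatenating two families and proving the result
  independent.\<close>

definition indep_invariants :: "complex \<Rightarrow> int list \<Rightarrow> nat \<Rightarrow> (nat \<Rightarrow> bool list \<Rightarrow> complex) \<Rightarrow> bool" where
  "indep_invariants q w n g \<longleftrightarrow> (\<forall>i<n. g i \<in> invariants q w) \<and>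
     (\<forall>c. (\<forall>s. (\<Sum>i<n. c i * g i s) = 0) \<longrightarrow> (\<forall>i<n. c i = 0))"

lemma indep_invariants_hom_dim: "indep_invariants q w n g \<Longrightarrow> n \<le> hom_dim q w"
  by (rule hom_dim_ge[of n g]) (simp_all add: indep_invariants_def)

lemma indep_invariants_insert_cup:
  assumes q: "q \<noteq> 0" and g: "indep_invariants q (u @ r) n g"
  shows "indep_invariants q (u @ a # (a + 2) # r) n (\<lambda>i. insert_cup q (length u) (g i))"
  unfolding indep_invariants_def
proof (intro conjI allI impI)
  show "insert_cup q (length u) (g i) \<in> invariants q (u @ a # (a + 2) # r)" if "i < n" for i
    using g that by (intro insert_cup_invariants[OF q]) (simp add: indep_invariants_def)
next
  fix c i assume eq: "\<forall>s. (\<Sum>i<n. c i * insert_cup q (length u) (g i) s) = 0" and i: "i < n"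
  have "(\<lambda>s. \<Sum>i<n. c i * g i s) \<in> invariants q (u @ r)"
    using g by (intro invariants_sum) (simp add: indep_invariants_def)
  note supp = invariants_supported[OF this]
  have "(\<Sum>i<n. c i * g i s) = 0" for s
    by (rule insert_cup_inj[OF q, of "length u" "length (u @ r)" "\<lambda>s. \<Sum>i<n. c i * g i s"])
      (use supp eq in \<open>auto simp: insert_cup_sum\<close>)
  then show "c i = 0" using g i by (simp add: indep_invariants_def)
qed

lemma sum_lessThan_add: "(\<Sum>i<m + n. h i) = (\<Sum>i<m. h i) + (\<Sum>i<n. h (m + i))" for h :: "nat \<Rightarrow> 'a :: comm_monoid_add"
  by (induction n) (simp_all add: add.assoc)

text \<open>The middle factor \<open>a + 2\<close> can be paired with its left or with its right neighbour, and the two resulting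
  spaces of invariants meet only in 0.\<close>

lemma indep_invariants_neighbours:
  assumes q: "q \<noteq> 0"
    and f: "indep_invariants q (u @ c # r) m f" and g: "indep_invariants q (u @ a # r) n g"
    and c: "c = a + 4"
  shows "\<exists>h. indep_invariants q (u @ a # (a + 2) # c # r) (m + n) h"
proof -
  let ?w = "u @ a # (a + 2) # c # r" and ?k = "length u"
  \<comment> \<open>The first family gains the cup on \<open>a\<close>, \<open>a + 2\<close>, the
    second the cup on \<open>a + 2\<close>, \<open>c\<close>. Both are cups because
    \<open>c = (a + 2) + 2\<close>.\<close>
  define h where "h i = (if i < m then insert_cup q ?k (f i) else insert_cup q (Suc ?k) (g (i - m)))" for i
  have f': "f i \<in> invariants q (u @ c # r)" if "i < m" for i
    using f that by (simp add: indep_invariants_def)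
  have g': "g i \<in> invariants q ((u @ [a]) @ r)" if "i < n" for i
    using g that by (simp add: indep_invariants_def)
  have "indep_invariants q ?w (m + n) h"
    unfolding indep_invariants_def
  proof (intro conjI allI impI)
    fix i assume "i < m + n"
    then show "h i \<in> invariants q ?w"
      using insert_cup_invariants[OF q f', of i a] insert_cup_invariants[OF q g', of "i - m" "a + 2"] c
      by (auto simp: h_def add.commute)
  next
    fix d i assume eq: "\<forall>s. (\<Sum>i<m + n. d i * h i s) = 0" and i: "i < m + n"
    define F where "F = (\<lambda>s. \<Sum>i<m. d i * f i s)"
    define G where "G = (\<lambda>s. \<Sum>i<n. d (m + i) * g i s)"
    have F: "F \<in> invariants q (u @ c # r)" unfolding F_def by (rule invariants_sum) (simp add: f')
    have G: "G \<in> invariants q ((u @ [a]) @ r)" unfolding G_def by (rule invariants_sum) (simp only: g' lessThan_iff)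
    have s: "insert_cup q ?k F s + insert_cup q (Suc ?k) G s = 0" for s
      using spec[OF eq, of s] by (simp add: F_def G_def insert_cup_sum sum_lessThan_add h_def)
    have F0: "F s = 0" for s
      by (rule insert_cup_neighbours[OF q, of ?k "length (u @ c # r)" F G])
        (use invariants_supported[OF F] s in auto)
    have "F = (\<lambda>s. 0 * F s)" using F0 by auto
    then have "insert_cup q ?k F = (\<lambda>s. 0)" using insert_cup_smult[of q ?k 0 F] by simp
    then have "insert_cup q (Suc ?k) G s = 0" for s using s by simp
    then have "G s = 0" for s
      using invariants_supported[OF G] insert_cup_inj[OF q, of "Suc ?k" "length ((u @ [a]) @ r)" G] by simp
    then have "\<forall>i<n. d (m + i) = 0" using g unfolding indep_invariants_def G_def by metis
    moreover have "\<forall>i<m. d i = 0" using f F0 unfolding indep_invariants_def F_def by metis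
    ultimately show "d i = 0" using i by (metis add_diff_inverse_nat nat_add_left_cancel_less)
  qed
  then show ?thesis by blast
qed

lemma zigzag_Suc_right: "zigzag 0 (Suc p) = [] @ 0 # (0 + 2) # zigzag 0 p"
  by (simp add: zigzag_def)

lemma concat_replicate_Suc: "concat (replicate (Suc n) xs) = concat (replicate n xs) @ xs"
  by (induction n) simp_all

text \<open>Deleting \<open>0, 2\<close> drops the first block of the right half. Deleting
  \<open>-2, 0\<close> leaves the 0 of the last left block next to the 2 of the first right block,
  and together they form a block \<open>0, 2\<close>.\<close>

lemma zigzag_Suc:
  obtains u r where "zigzag (Suc m) (Suc p) = u @ (-2) # (-2 + 2) # 2 # r"
    "zigzag m (Suc p) = u @ 2 # r" "zigzag (Suc m) p = u @ (-2) # r"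
proof
  let ?u = "concat (replicate m [0, -2]) @ [0 :: int]" and ?r = "concat (replicate p [0, 2]) :: int list"
  show "zigzag (Suc m) (Suc p) = ?u @ (-2) # (-2 + 2) # 2 # ?r"
    by (simp add: zigzag_def concat_replicate_Suc[of m] del: replicate.simps) simp
  show "zigzag m (Suc p) = ?u @ 2 # ?r" by (simp add: zigzag_def)
  show "zigzag (Suc m) p = ?u @ (-2) # ?r"
    by (simp add: zigzag_def concat_replicate_Suc[of m] del: replicate.simps)
qed

lemma zigzag_words: "zigzag m p \<in> words (2 * (m + p))"
proof -
  have "length (concat (replicate n [a, b])) = 2 * n" "set (concat (replicate n [a, b])) \<subseteq> {a, b}" for n and a b :: int
    by (induction n) auto
  then show ?thesis unfolding words_def zigzag_def by fastforce
qed

text \<open>The shift by one in the upper index encodes the boundary values. For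
  \<open>m = 0\<close> cups placed side by side give one invariant, for \<open>p = 0 < m\<close>
  nothing is claimed, and at \<open>m = p = 0\<close> truncated subtraction yields the single
  invariant of the empty word.\<close>

lemma hom_dim_zigzag:
  assumes q: "q \<noteq> 0"
  shows "(m + p - 1) choose m \<le> hom_dim q (zigzag m p)"
proof -
  have "\<exists>g. indep_invariants q (zigzag m p) ((m + p - 1) choose m) g"
  proof (induction "m + p" arbitrary: m p)
    case 0
    have "indep_invariants q (zigzag 0 0) 1 (\<lambda>_ s. if s = [] then 1 else 0)"
      by (auto simp: indep_invariants_def invariants_def zigzag_def)
    then show ?case using 0 by auto
  next
    case (Suc k)
    show ?case
    proof (cases m; cases p)
      assume "m = 0" "p = 0"
      then show ?thesis using Suc.hyps(2) by simp
    next
      fix p' assume m: "m = 0" and p: "p = Suc p'"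
      obtain g where "indep_invariants q (zigzag 0 p') 1 g"
        using Suc.hyps(1)[of 0 p'] Suc.hyps(2) m p by auto
      then show ?thesis
        using indep_invariants_insert_cup[OF q, of "[]" "zigzag 0 p'" 1 g 0] m p
        by (auto simp: zigzag_Suc_right)
    next
      fix m' assume m: "m = Suc m'" "p = 0"
      have "indep_invariants q w 0 g" for w g by (simp add: indep_invariants_def)
      moreover have "(m + p - 1) choose m = 0" using m by simp
      ultimately show ?thesis by metis
    next
      fix m' p' assume m: "m = Suc m'" and p: "p = Suc p'"
      obtain u r where ur: "zigzag m p = u @ (-2) # (-2 + 2) # 2 # r"
        "zigzag m' p = u @ 2 # r" "zigzag m p' = u @ (-2) # r"
        using zigzag_Suc[of m' p'] m p by metis
      obtain f g where fg: "indep_invariants q (u @ 2 # r) ((m' + p - 1) choose m') f"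
        "indep_invariants q (u @ (-2) # r) ((m + p' - 1) choose m) g"
        using Suc.hyps(1)[of m' p, unfolded ur] Suc.hyps(1)[of m p', unfolded ur] Suc.hyps(2) m p by fastforce
      have "((m' + p - 1) choose m') + ((m + p' - 1) choose m) = (m + p - 1) choose m"
        using m p by simp
      then show ?thesis
        using indep_invariants_neighbours[OF q fg] by (simp add: ur)
    qed
  qed
  then show ?thesis using indep_invariants_hom_dim by blast
qed

lemma hom_dim_Cons_Cons:
  assumes q: "q \<noteq> 0"
  shows "hom_dim q w \<le> hom_dim q (a # (a + 2) # w)"
proof (rule hom_dim_mono_linear[where P = "insert_cup q 0"])
  show "insert_cup q 0 f \<in> invariants q (a # (a + 2) # w)" if "f \<in> invariants q w" for f
    using insert_cup_invariants[OF q, of f "[]" w a] that by simp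
  show "f = (\<lambda>_. 0)" if f: "f \<in> invariants q w" and z: "insert_cup q 0 f = (\<lambda>_. 0)" for f
  proof
    show "f s = 0" for s
      by (rule insert_cup_inj[OF q, of 0 "length w" f]) (use invariants_supported[OF f] z in auto)
  qed
qed (simp_all only: insert_cup_add insert_cup_smult)

section \<open>Highest weight vectors and ballot sequences\<close>

primrec weight :: "bool list \<Rightarrow> int" where
  "weight [] = 0"
| "weight (b # s) = weight s + (if b then -1 else 1)"

definition weighted :: "nat \<Rightarrow> int \<Rightarrow> (bool list \<Rightarrow> complex) \<Rightarrow> bool" where
  "weighted k m f \<longleftrightarrow> (\<forall>s. f s \<noteq> 0 \<longrightarrow> length s = k \<and> weight s = m)"

lemma word_op_Kp:
  assumes "q \<noteq> 0" "length s = length w"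
  shows "word_op q w Kp f s = q powi weight s * f s"
  using assms(2)
proof (induction w arbitrary: f s)
  case (Cons a w)
  then obtain b t where "s = b # t" "length t = length w" by (metis length_Suc_conv)
  then show ?case using Cons.IH assms(1) by (simp add: Let_def power_int_add power_int_diff divide_inverse)
qed simp

lemma weighted_Cons:
  assumes "weighted (Suc k) m f"
  shows "weighted k (m - 1) (\<lambda>t. f (False # t))" "weighted k (m + 1) (\<lambda>t. f (True # t))"
  using assms by (fastforce simp: weighted_def)+

text \<open>No condition on the length of \<open>s\<close>: off the right length both sides are 0.
  Thus \<open>K\<close> can be replaced by a scalar everywhere.\<close>

lemma word_op_Kp_weighted:
  assumes "q \<noteq> 0" "weighted (length w) m f"
  shows "word_op q w Kp f s = q powi m * f s"
  using assms(2)
proof (induction w arbitrary: f m s)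
  case Nil
  then show ?case by (cases "f s = 0") (auto simp: weighted_def)
next
  case (Cons a w)
  have "word_op q w Kp (\<lambda>t. f (False # t)) t = q powi (m - 1) * f (False # t)" for t
    using Cons.IH[OF weighted_Cons(1)] Cons.prems by simp
  moreover have "word_op q w Kp (\<lambda>t. f (True # t)) t = q powi (m + 1) * f (True # t)" for t
    using Cons.IH[OF weighted_Cons(2)] Cons.prems by simp
  moreover have "f [] = 0" using Cons.prems by (auto simp: weighted_def)
  ultimately show ?case
    using assms(1) by (cases s) (simp_all add: Let_def power_int_add power_int_diff)
qed

text \<open>The coproduct term \<open>e_1 \<otimes> K\<close> moves the \<open>v_-\<close> component
  into the \<open>v_+\<close> component, and that component has weight \<open>m + 1\<close>.\<close>

lemma word_op_E1_False:
  assumes "q \<noteq> 0" "weighted (Suc (length w)) m f"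
  shows "word_op q (a # w) E1 f (False # t) =
    q powi (m + 1) * f (True # t) + word_op q w E1 (\<lambda>t. f (False # t)) t"
  using word_op_Kp_weighted[OF assms(1) weighted_Cons(2)[OF assms(2)]] by simp

lemma weighted_E1:
  assumes q: "q \<noteq> 0" and f: "weighted (length w) m f"
  shows "weighted (length w) (m + 2) (word_op q w E1 f)"
  using f
proof (induction w arbitrary: f m)
  case Nil
  then show ?case by (simp add: weighted_def)
next
  case (Cons a w)
  have f: "weighted (Suc (length w)) m f" using Cons.prems by simp
  have x: "weighted (length w) (m + 1) (word_op q w E1 (\<lambda>t. f (False # t)))"
    using Cons.IH[OF weighted_Cons(1)[OF f]] by (simp add: add.commute)
  have y: "weighted (length w) (m + 3) (word_op q w E1 (\<lambda>t. f (True # t)))"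
    using Cons.IH[OF weighted_Cons(2)[OF f]] by (simp add: add.commute)
  show ?case
    unfolding weighted_def
  proof (intro allI impI)
    fix s assume ne: "word_op q (a # w) E1 f s \<noteq> 0"
    show "length s = length (a # w) \<and> weight s = m + 2"
    proof (cases s)
      case Nil
      then show ?thesis using ne by simp
    next
      case (Cons b t)
      show ?thesis
      proof (cases b)
        case True
        then show ?thesis using y ne Cons by (auto simp: weighted_def)
      next
        case False
        then have "f (True # t) \<noteq> 0 \<or> word_op q w E1 (\<lambda>t. f (False # t)) t \<noteq> 0"
          using ne Cons word_op_E1_False[OF q f, of a t] by auto
        then show ?thesis using False x weighted_Cons(2)[OF f] Cons by (auto simp: weighted_def)
      qed
    qed
  qed
qed

section \<open>Powers of \<open>e_1\<close> on weight spaces\<close>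

lemma weighted_E1_pow:
  assumes "q \<noteq> 0" "weighted (length w) m f"
  shows "weighted (length w) (m + 2 * int j) ((word_op q w E1 ^^ j) f)"
proof (induction j)
  case (Suc j)
  then show ?case using weighted_E1[OF assms(1) Suc] by (simp add: algebra_simps)
qed (simp add: assms)

lemma word_op_add: "word_op q w g (\<lambda>s. f s + h s) s = word_op q w g f s + word_op q w g h s"
  using word_op_sum[of q w g "\<lambda>_. 1" "\<lambda>b. if b then f else h" UNIV] by (simp add: UNIV_bool add.commute)

lemma E1_pow_True: "(word_op q (a # w) E1 ^^ j) f (True # t) = (word_op q w E1 ^^ j) (\<lambda>t. f (True # t)) t"
  by (induction j arbitrary: t) simp_all

text \<open>The \<open>v_-\<close> component crosses to \<open>v_+\<close> in exactly one of the
  \<open>Suc j\<close> applications. If it has been raised \<open>i\<close> times before, its weight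
  is then \<open>m + 1 + 2 * i\<close>, which gives the power of \<open>q\<close>; the other
  \<open>j\<close> applications act on it as \<open>e_1\<close>.\<close>

lemma E1_pow_False:
  assumes q: "q \<noteq> 0" and f: "weighted (Suc (length w)) m f"
  shows "(word_op q (a # w) E1 ^^ Suc j) f (False # t) =
    (\<Sum>i\<le>j. q powi (m + 1 + 2 * int i)) * (word_op q w E1 ^^ j) (\<lambda>t. f (True # t)) t +
    (word_op q w E1 ^^ Suc j) (\<lambda>t. f (False # t)) t"
proof (induction j arbitrary: t)
  case 0
  show ?case using word_op_E1_False[OF q f, of a t] by simp
next
  case (Suc j)
  let ?F = "(word_op q (a # w) E1 ^^ Suc j) f"
  have F: "weighted (Suc (length w)) (m + 2 * int (Suc j)) ?F"
    using weighted_E1_pow[OF q, of "a # w" m f "Suc j"] f by simp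
  have "(word_op q (a # w) E1 ^^ Suc (Suc j)) f (False # t) =
    q powi (m + 2 * int (Suc j) + 1) * ?F (True # t) + word_op q w E1 (\<lambda>t. ?F (False # t)) t"
    using word_op_E1_False[OF q F, of a t] by simp
  also have "?F (True # t) = (word_op q w E1 ^^ Suc j) (\<lambda>t. f (True # t)) t" by (rule E1_pow_True)
  also have "word_op q w E1 (\<lambda>t. ?F (False # t)) t =
    (\<Sum>i\<le>j. q powi (m + 1 + 2 * int i)) * (word_op q w E1 ^^ Suc j) (\<lambda>t. f (True # t)) t +
    (word_op q w E1 ^^ Suc (Suc j)) (\<lambda>t. f (False # t)) t"
    unfolding Suc word_op_add word_op_smult by simp
  finally show ?case by (simp add: algebra_simps)
qed

text \<open>A geometric sum of ratio \<open>q^2\<close>, hence a q-integer up to a power of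
  \<open>q\<close>. It could vanish only if \<open>q\<close> were a root of unity.\<close>

lemma q_int_sum_nonzero:
  fixes q :: complex
  assumes "q \<noteq> 0" "\<And>k::nat. k > 0 \<Longrightarrow> q ^ k \<noteq> 1"
  shows "(\<Sum>i\<le>j. q powi (m + 2 * int i)) \<noteq> 0"
proof -
  have "(\<Sum>i\<le>j. q powi (m + 2 * int i)) = q powi m * (\<Sum>i<Suc j. (q^2) ^ i)"
    using assms(1) unfolding sum_distrib_left
    by (simp add: power_int_add power_int_mult lessThan_Suc_atMost)
  also have "\<dots> = q powi m * (((q^2) ^ Suc j - 1) / (q^2 - 1))"
    using assms(2)[of 2] by (subst geometric_sum) auto
  also have "\<dots> \<noteq> 0"
    using assms(1) assms(2)[of 2] assms(2)[of "2 * Suc j"] unfolding power_mult[symmetric] by simp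
  finally show ?thesis .
qed

lemma E1_pow_zero: "(word_op q w E1 ^^ j) (\<lambda>_. 0) = (\<lambda>_. 0)"
proof (induction j)
  case (Suc j)
  then show ?case by (simp add: word_op_zero[abs_def])
qed simp

text \<open>Writing \<open>f = (x, y)\<close>, the equation \<open>E\<^sup>j f = 0\<close> reads \<open>E\<^sup>j y = 0\<close> and \<open>E\<^sup>j x = c E\<^sup>j\<^sup>-\<^sup>1 y\<close> with \<open>c \<noteq> 0\<close>.
  Applying \<open>E\<close> to the second equation gives \<open>E\<^sup>j\<^sup>+\<^sup>1 x = 0\<close>, so \<open>x = 0\<close> and then \<open>E\<^sup>j\<^sup>-\<^sup>1 y = 0\<close>.\<close>

lemma E1_pow_inj:
  assumes q: "q \<noteq> 0" "\<And>k::nat. k > 0 \<Longrightarrow> q ^ k \<noteq> 1"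
    and f: "weighted (length w) (- int j) f" "(word_op q w E1 ^^ j) f = (\<lambda>_. 0)"
  shows "f = (\<lambda>_. 0)"
  using f
proof (induction w arbitrary: j f)
  case Nil
  show ?case
  proof (cases j)
    case (Suc i)
    then show ?thesis using Nil by (fastforce simp: weighted_def)
  qed (use Nil in simp)
next
  case (Cons a w)
  show ?case
  proof (cases j)
    case 0
    then show ?thesis using Cons.prems by simp
  next
    case (Suc i)
    define x where "x = (\<lambda>t. f (False # t))"
    define y where "y = (\<lambda>t. f (True # t))"
    define c where "c = (\<Sum>k\<le>i. q powi (- int j + 1 + 2 * int k))"
    let ?E = "word_op q w E1"
    have f: "weighted (Suc (length w)) (- int j) f" using Cons.prems by simp
    \<comment> \<open>The component \<open>x\<close> has weight \<open>-(j + 1)\<close>, so the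
      induction hypothesis wants the exponent \<open>j + 1\<close> for it; \<open>y\<close> has
      weight \<open>-(j - 1)\<close> and wants \<open>j - 1\<close>.\<close>
    have wx: "weighted (length w) (- int (Suc j)) x" proof -
      have "- int j - 1 = - int (Suc j)" by simp
      then show ?thesis using weighted_Cons(1)[OF f] by (simp only: x_def)
    qed
    have wy: "weighted (length w) (- int i) y" using weighted_Cons(2)[OF f] Suc by (simp add: y_def)
    have c: "c \<noteq> 0" unfolding c_def by (rule q_int_sum_nonzero[OF q])
    have Ey: "(?E ^^ j) y = (\<lambda>_. 0)"
      using E1_pow_True[where q = q and a = a and w = w and j = j and f = f] Cons.prems(2) by (simp add: y_def fun_eq_iff)
    have Ex: "c * (?E ^^ i) y t + (?E ^^ j) x t = 0" for t
      using E1_pow_False[OF q(1) f, where a = a and j = i and t = t, folded Suc] Cons.prems(2) by (simp add: x_def y_def c_def)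
    have "(?E ^^ j) x = (\<lambda>t. - c * (?E ^^ i) y t)"
      using Ex by (auto simp: fun_eq_iff add_eq_0_iff)
    then have "(?E ^^ Suc j) x t = - c * (?E ^^ j) y t" for t
      using word_op_smult[of q w E1 "- c"] Suc by simp
    then have "(?E ^^ Suc j) x = (\<lambda>_. 0)" unfolding Ey by (intro ext) simp
    then have x: "x = (\<lambda>_. 0)" by (rule Cons.IH[OF wx])
    then have "(?E ^^ i) y = (\<lambda>_. 0)" using Ex c by (intro ext) (simp add: E1_pow_zero)
    then have y: "y = (\<lambda>_. 0)" by (rule Cons.IH[OF wy])
    have "f [] = 0" using f by (auto simp: weighted_def)
    show ?thesis
    proof
      fix s show "f s = 0"
      proof (cases s)
        case (Cons b t)
        then show ?thesis using fun_cong[OF x, of t] fun_cong[OF y, of t] by (cases b) (simp_all add: x_def y_def)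
      qed (use \<open>f [] = 0\<close> in simp)
    qed
  qed
qed

text \<open>The lists of weight \<open>m\<close> all of whose suffixes have nonnegative weight.\<close>

primrec ballot :: "nat \<Rightarrow> int \<Rightarrow> bool list set" where
  "ballot 0 m = (if m = 0 then {[]} else {})"
| "ballot (Suc k) m = (if m < 0 then {} else Cons False ` ballot k (m - 1) \<union> Cons True ` ballot k (m + 1))"

text \<open>The equation is triangular: its \<open>v_-\<close> component says that
  \<open>e_1\<close> kills \<open>y\<close>, and once \<open>y = 0\<close> its \<open>v_+\<close>
  component says that \<open>e_1\<close> kills \<open>x\<close>. Since the first factor is removed
  at each step, the surviving positions are controlled by suffixes.\<close>

lemma highest_weight_ballot:
  assumes q: "q \<noteq> 0" "\<And>k::nat. k > 0 \<Longrightarrow> q ^ k \<noteq> 1"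
    and f: "weighted (length w) m f" "word_op q w E1 f = (\<lambda>_. 0)" "\<forall>s\<in>ballot (length w) m. f s = 0"
  shows "f = (\<lambda>_. 0)"
  using f
proof (induction w arbitrary: m f)
  case Nil
  show ?case
  proof
    fix s show "f s = 0"
      using Nil by (cases "f s = 0") (auto simp: weighted_def)
  qed
next
  case (Cons a w)
  show ?case
  proof (cases "m < 0")
    case True
    \<comment> \<open>A vector killed by \<open>e_1\<close> is killed by the power
      \<open>-m\<close>, which is at least 1, and on weight \<open>m\<close> that power is
      injective.\<close>
    define i where "i = nat (- m) - 1"
    have i: "m = - int (Suc i)" using True by (simp add: i_def)
    have "(word_op q (a # w) E1 ^^ Suc i) f = (word_op q (a # w) E1 ^^ i) (word_op q (a # w) E1 f)"
      by (simp only: funpow_Suc_right comp_apply)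
    then have "(word_op q (a # w) E1 ^^ Suc i) f = (\<lambda>_. 0)"
      unfolding Cons.prems(2) E1_pow_zero .
    then show ?thesis using E1_pow_inj[OF q, of "a # w" "Suc i" f] Cons.prems(1) i by blast
  next
    case False
    define x where "x = (\<lambda>t. f (False # t))"
    define y where "y = (\<lambda>t. f (True # t))"
    have f: "weighted (Suc (length w)) m f" using Cons.prems by simp
    have b: "ballot (length (a # w)) m = Cons False ` ballot (length w) (m - 1) \<union> Cons True ` ballot (length w) (m + 1)"
      using False by simp
    have Ey: "word_op q w E1 y = (\<lambda>_. 0)"
      using fun_cong[OF Cons.prems(2), of "True # _"] by (simp add: y_def fun_eq_iff)
    have y: "y = (\<lambda>_. 0)"
      by (rule Cons.IH[OF _ Ey]) (use weighted_Cons(2)[OF f] Cons.prems(3) b in \<open>auto simp: y_def\<close>)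
    have "q powi (m + 1) * y t + word_op q w E1 x t = 0" for t
      using word_op_E1_False[OF q(1) f, of a t] fun_cong[OF Cons.prems(2), of "False # t"] by (simp add: x_def y_def)
    then have Ex: "word_op q w E1 x = (\<lambda>_. 0)" by (simp add: y fun_eq_iff)
    have x: "x = (\<lambda>_. 0)"
      by (rule Cons.IH[OF _ Ex]) (use weighted_Cons(1)[OF f] Cons.prems(3) b in \<open>auto simp: x_def\<close>)
    have "f [] = 0" using f by (auto simp: weighted_def)
    show ?thesis
    proof
      fix s show "f s = 0"
      proof (cases s)
        case (Cons b t)
        then show ?thesis using fun_cong[OF x, of t] fun_cong[OF y, of t] by (cases b) (simp_all add: x_def y_def)
      qed (use \<open>f [] = 0\<close> in simp)
    qed
  qed
qed

section \<open>Counting ballot sequences\<close>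

lemma finite_ballot: "finite (ballot k m)"
  by (induction k arbitrary: m) auto

lemma ballot_empty: "int k < m \<or> m < 0 \<Longrightarrow> ballot k m = {}"
  by (induction k arbitrary: m) auto

lemma card_ballot_Suc:
  assumes "m \<ge> 0"
  shows "card (ballot (Suc k) m) = card (ballot k (m - 1)) + card (ballot k (m + 1))"
proof -
  have "card (ballot (Suc k) m) = card (Cons False ` ballot k (m - 1)) + card (Cons True ` ballot k (m + 1))"
    using assms by (simp only: ballot.simps not_less[symmetric] if_False) (rule card_Un_disjoint, auto simp: finite_ballot)
  then show ?thesis by (simp add: card_image)
qed

lemma choose_step:
  fixes n j :: nat
  shows "((n + 2 * j + 2) choose (j + 1)) * (j + 1) = (n + j + 2) * ((n + 2 * j + 2) choose j)"
proof -
  have "Suc j * ((n + 2 * j + 2) choose Suc j) = (n + 2 * j + 2 - j) * ((n + 2 * j + 2) choose j)"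
    by (metis binomial_absorb_comp binomial_absorption)
  then show ?thesis by (simp add: mult.commute)
qed

text \<open>The ballot numbers with denominators cleared; \<open>j\<close> counts the signs
  \<open>True\<close>, and \<open>n = 0\<close> gives the Catalan numbers. The induction is on the
  length because the recurrence moves the weight both up and down.\<close>

lemma card_ballot: "card (ballot (n + 2 * j) (int n)) * (n + j + 1) = (n + 1) * ((n + 2 * j) choose j)"
proof (induction "n + 2 * j" arbitrary: n j)
  case 0
  then show ?case by simp
next
  case (Suc k)
  show ?case
  proof (cases n)
    case 0
    then obtain i where j: "j = Suc i" and k: "k = 1 + 2 * i" using Suc.hyps(2) by (cases j) auto
    have "card (ballot (Suc k) 0) = card (ballot k 1)"
      by (simp only: card_ballot_Suc order.refl) (simp add: ballot_empty)
    moreover have "card (ballot k 1) * (i + 2) = 2 * (k choose i)"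
      using Suc.hyps(1)[of 1 i] k by simp
    \<comment> \<open>Row \<open>k = 2 * i + 1\<close> is odd, so its two middle entries agree and
      Pascal's rule yields \<open>2 * (k choose i)\<close>.\<close>
    moreover have "(k choose Suc i) = k choose i"
      using binomial_symmetric[of i k] k by simp
    ultimately show ?thesis using 0 j k Suc.hyps(2) by simp
  next
    case n: (Suc n')
    have shift: "int n - 1 = int n'" "int n + 1 = int n' + 2" using n by simp_all
    show ?thesis
    proof (cases j)
      case 0
      have "ballot k (int n' + 2) = {}" using Suc.hyps(2) n 0 by (intro ballot_empty) auto
      then have "card (ballot (Suc k) (int n)) = card (ballot k (int n'))"
        using card_ballot_Suc[of "int n" k] by (simp only: shift; simp)
      moreover have "card (ballot k (int n')) * (n' + 1) = 1 * (n' + 1)"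
        using Suc.hyps(1)[of n' 0] Suc.hyps(2) n 0 by simp
      then have "card (ballot k (int n')) = 1" unfolding mult_cancel2 by simp
      ultimately show ?thesis using Suc.hyps(2) n 0 by (simp del: ballot.simps)
    next
      case j: (Suc i)
      have k: "k = n' + 2 * i + 2" using Suc.hyps(2) n j by simp
      let ?c = "card (ballot k (int n'))" and ?d = "card (ballot k (int n' + 2))"
      have c: "card (ballot (Suc k) (int n)) = ?c + ?d"
        using card_ballot_Suc[of "int n" k] by (simp only: shift; simp)
      have 1: "?c * (n' + i + 2) = (n' + 1) * (k choose (i + 1))"
        using Suc.hyps(1)[of n' "i + 1"] k by (simp add: algebra_simps)
      have 2: "?d * (n' + i + 3) = (n' + 3) * (k choose i)"
        using Suc.hyps(1)[of "n' + 2" i] k by (simp add: algebra_simps)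
      have 3: "(k choose (i + 1)) * (i + 1) = (n' + i + 2) * (k choose i)"
        unfolding k by (rule choose_step)
      \<comment> \<open>The factor \<open>i + 1\<close> expresses \<open>?c\<close> through
        \<open>k choose i\<close>, the binomial that already occurs in the formula for
        \<open>?d\<close>.\<close>
      have "(?c * (i + 1)) * (n' + i + 2) = ((n' + 1) * (k choose i)) * (n' + i + 2)"
        using 1 3 by (metis mult.assoc mult.commute)
      then have 4: "?c * (i + 1) = (n' + 1) * (k choose i)" unfolding mult_cancel2 by simp
      have "((?c + ?d) * (n' + i + 3)) * (i + 1) = (?c * (i + 1)) * (n' + i + 3) + (?d * (n' + i + 3)) * (i + 1)"
        by (simp only: algebra_simps)
      also have "\<dots> = (n' + 2) * ((k choose i) * (i + 1) + (n' + i + 2) * (k choose i))"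
        unfolding 2 4 by (simp add: algebra_simps)
      also have "\<dots> = ((n' + 2) * ((k choose i) + (k choose (i + 1)))) * (i + 1)"
        unfolding 3[symmetric] by (simp only: algebra_simps)
      finally have 5: "(?c + ?d) * (n' + i + 3) = (n' + 2) * ((k choose i) + (k choose (i + 1)))"
        unfolding mult_cancel2 by simp
      have "n + j + 1 = n' + i + 3" "n + 1 = n' + 2" "n + 2 * j = Suc k"
        "(Suc k choose j) = (k choose i) + (k choose (i + 1))"
        using n j Suc.hyps(2) by simp_all
      then show ?thesis using c 5 by (simp only:)
    qed
  qed
qed

lemma hom_dim_le_catalan:
  assumes q: "q \<noteq> 0" "\<And>k::nat. k > 0 \<Longrightarrow> q ^ k \<noteq> 1" and w: "length w = 2 * n"
  shows "hom_dim q w * (n + 1) \<le> (2 * n) choose n"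
proof -
  have "hom_dim q w \<le> card (ballot (2 * n) 0)"
  proof (rule hom_dim_le_card[OF finite_ballot])
    fix f assume f: "f \<in> invariants q w" and z: "\<forall>s\<in>ballot (2 * n) 0. f s = 0"
    \<comment> \<open>Invariance under \<open>K\<close> reads \<open>q powi weight s = 1\<close>
      wherever \<open>f s\<close> is nonzero, and no positive power of \<open>q\<close> is
      1.\<close>
    have "weight s = 0" "length s = length w" if "f s \<noteq> 0" for s
    proof -
      show l: "length s = length w" using invariants_supported[OF f] that by blast
      have "q powi weight s * f s = f s"
        using word_op_Kp[OF q(1) l, of f] f l by (simp add: invariants_def)
      then have 1: "q powi weight s = 1" using that by simp
      show "weight s = 0"
      proof (rule ccontr)
        assume "weight s \<noteq> 0"
        then have "q ^ nat \<bar>weight s\<bar> \<noteq> 1" by (intro q(2)) simp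
        then show False using 1 by (auto simp: power_int_def power_inverse split: if_splits)
      qed
    qed
    then have wt: "weighted (length w) 0 f" by (auto simp: weighted_def)
    have "word_op q w E1 f s = 0" for s
      using f word_op_supported[of w f s q E1] invariants_supported[OF f]
      by (cases "length s = length w") (simp_all add: invariants_def)
    then have E: "word_op q w E1 f = (\<lambda>_. 0)" by (simp add: fun_eq_iff)
    show "f = (\<lambda>_. 0)"
      by (rule highest_weight_ballot[OF q wt E]) (assumption, rule z[folded w])
  qed
  then show ?thesis using card_ballot[of 0 n] by (metis add_0 mult_le_mono1 mult_1 of_nat_0 Suc_eq_plus1)
qed

section \<open>The sequence of maxima\<close>

lemma b_seq_attained:
  assumes "q \<noteq> 0" "q ^ 2 \<noteq> 1"
  obtains w where "w \<in> words (2 * n)" "b_seq q n = hom_dim q w"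
  using Max_in[OF hom_dim_words[OF assms, of "2 * n"]] unfolding b_seq_def by (metis imageE)

lemma hom_dim_le_b_seq:
  assumes "q \<noteq> 0" "q ^ 2 \<noteq> 1" "w \<in> words (2 * n)"
  shows "hom_dim q w \<le> b_seq q n"
  unfolding b_seq_def by (rule Max_ge[OF hom_dim_words(1)[OF assms(1,2)]]) (use assms(3) in blast)

lemma b_seq_mono:
  assumes q: "q \<noteq> 0" "q ^ 2 \<noteq> 1"
  shows "m \<le> n \<Longrightarrow> b_seq q m \<le> b_seq q n"
proof (rule lift_Suc_mono_le[of "b_seq q"])
  fix n
  obtain w where w: "w \<in> words (2 * n)" "b_seq q n = hom_dim q w" by (rule b_seq_attained[OF q])
  have "0 # (0 + 2) # w \<in> words (2 * Suc n)" using w(1) by (auto simp: words_def)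
  then show "b_seq q n \<le> b_seq q (Suc n)"
    using hom_dim_Cons_Cons[OF q(1), of w 0] hom_dim_le_b_seq[OF q] w(2) by (metis order.trans)
qed

text \<open>The split of the index is free: equal or nearly equal parts give the stated bounds, and
  taking \<open>m\<close> as half of the row number gives the central binomial coefficient.\<close>

lemma b_seq_ge:
  assumes q: "q \<noteq> 0" "q ^ 2 \<noteq> 1"
  shows "(m + p - 1) choose m \<le> b_seq q (m + p)"
  using hom_dim_zigzag[OF q(1)] hom_dim_le_b_seq[OF q zigzag_words] by (rule order.trans)

lemma b_seq_le:
  assumes q: "q \<noteq> 0" "\<And>k::nat. k > 0 \<Longrightarrow> q ^ k \<noteq> 1"
  shows "real (b_seq q n) \<le> 1 / real (n + 1) * real ((2 * n) choose n)"
proof -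
  obtain w where w: "w \<in> words (2 * n)" "b_seq q n = hom_dim q w"
    by (rule b_seq_attained[OF q(1)]) (use q(2) in auto)
  have "b_seq q n * (n + 1) \<le> (2 * n) choose n"
    unfolding w(2) using w(1) by (intro hom_dim_le_catalan[OF q]) (simp_all add: words_def)
  then have "real (b_seq q n) * real (n + 1) \<le> real ((2 * n) choose n)"
    by (metis of_nat_le_iff of_nat_mult)
  then show ?thesis by (simp add: field_simps)
qed

text \<open>The \<open>k + 1\<close> entries of a row add up to \<open>2 ^ k\<close>, and the middle
  one is the largest.\<close>

lemma two_power_le_choose:
  "2 ^ k \<le> (k + 1) * (k choose (k div 2))"
proof -
  have "(2::nat) ^ k = (\<Sum>i\<le>k. k choose i)" by (rule choose_row_sum[symmetric])
  also have "\<dots> \<le> (\<Sum>i\<le>k. k choose (k div 2))" by (intro sum_mono binomial_maximum)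
  finally show ?thesis by simp
qed

text \<open>The central entry of row \<open>n - 1\<close> is at least
  \<open>2 ^ (n - 1) / n\<close>. The loss of a factor \<open>2 * n\<close> against
  \<open>2 ^ n\<close> is absorbed once \<open>n * (a / 2) ^ n\<close> is below 1/2.\<close>

lemma b_seq_exponential:
  assumes q: "q \<noteq> 0" "q ^ 2 \<noteq> 1" and a: "0 < a" "a < 2"
  shows "\<forall>\<^sub>F n in sequentially. a ^ n \<le> real (b_seq q n)"
proof -
  have "(\<lambda>n. real n * (a / 2) ^ n) \<longlonglongrightarrow> 0"
    using a by (intro powser_times_n_limit_0) simp
  then have "\<forall>\<^sub>F n in sequentially. real n * (a / 2) ^ n < 1 / 2"
    by (rule order_tendstoD) simp
  then show ?thesis
    using eventually_gt_at_top[of 0]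
  proof eventually_elim
    case (elim n)
    let ?m = "(n - 1) div 2"
    have "(2::real) ^ n = 2 * real (2 ^ (n - 1))" using elim by (cases n) auto
    also have "\<dots> \<le> 2 * real (n * ((n - 1) choose ?m))"
      using two_power_le_choose[of "n - 1"] elim by (simp del: of_nat_mult of_nat_power)
    also have "\<dots> \<le> 2 * real (n * b_seq q n)"
      using b_seq_ge[OF q, of ?m "n - ?m"] by (simp add: mult_left_mono)
    finally have "2 ^ n \<le> 2 * real n * real (b_seq q n)" by simp
    moreover have "real n * a ^ n < 2 ^ n / 2" using elim by (simp add: power_divide field_simps)
    ultimately have "real n * a ^ n < real n * real (b_seq q n)" by simp
    then show ?case using elim by simp
  qed
qed

theorem proposition8p8:
  fixes q :: complex
  assumes "q \<noteq> 0" and "\<And>k::nat. k > 0 \<Longrightarrow> q ^ k \<noteq> 1"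
  shows "(\<forall>m n. 1 \<le> m \<and> m \<le> n \<longrightarrow> b_seq q m \<le> b_seq q n) \<and>
    (\<forall>n::nat. n > 0 \<longrightarrow>
       (2 * n) choose n \<le> b_seq q (2 * n + 1) \<and>
       real (b_seq q (2 * n + 1)) \<le> 1 / real (2 * n + 2) * real ((4 * n + 2) choose (2 * n + 1)) \<and>
       (2 * n - 1) choose n \<le> b_seq q (2 * n) \<and>
       real (b_seq q (2 * n)) \<le> 1 / real (2 * n + 1) * real ((4 * n) choose (2 * n))) \<and>
    (\<forall>a::real. 0 < a \<and> a < 2 \<longrightarrow> (\<forall>\<^sub>F n in sequentially. real (b_seq q n) \<ge> a ^ n))"
proof (intro conjI allI impI)
  have q2: "q ^ 2 \<noteq> 1" using assms(2)[of 2] by simp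
  note q = assms(1) q2
  show "b_seq q m \<le> b_seq q n" if "1 \<le> m \<and> m \<le> n" for m n
    using b_seq_mono[OF q] that by blast
  show "\<forall>\<^sub>F n in sequentially. real (b_seq q n) \<ge> a ^ n" if "0 < a \<and> a < 2" for a :: real
    using b_seq_exponential[OF q] that by blast
  fix n :: nat assume "n > 0"
  show "(2 * n) choose n \<le> b_seq q (2 * n + 1)"
    using b_seq_ge[OF q, of n "n + 1"] by (simp add: mult_2)
  show "(2 * n - 1) choose n \<le> b_seq q (2 * n)"
    using b_seq_ge[OF q, of n n] by (simp add: mult_2)
  show "real (b_seq q (2 * n + 1)) \<le> 1 / real (2 * n + 2) * real ((4 * n + 2) choose (2 * n + 1))"
    using b_seq_le[OF assms, of "2 * n + 1"] by (simp add: algebra_simps)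
  show "real (b_seq q (2 * n)) \<le> 1 / real (2 * n + 1) * real ((4 * n) choose (2 * n))"
    using b_seq_le[OF assms, of "2 * n"] by (simp add: algebra_simps)
qed

end
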